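(* Let $\mathcal{A}$ be a $C^{\ast}$-algebra, let $\mathcal{B}$ be a Banach algebra, let $\mathcal{M}$ be a Banach $\mathcal{B}$-bimodule and let $\sigma, \tau:\mathcal{A} \rightarrow \mathcal{B}$ be mappings which are continuous at zero. Let $D: \mathcal{A} \rightarrow \mathcal{M}$ be a generalized $(\sigma, \tau)$-derivation associated with a linear mapping $d:\mathcal{A} \rightarrow \mathcal{M}$. Moreover, assume that either $(\tau(ab) - \tau(a)\tau(b))d(c) = 0$ for all $a, b, c \in \mathcal{A}$, or $D(c) (\sigma(ab) - \sigma(a)\sigma(b)) = 0$ for all $a, b, c \in \mathcal{A}$. Then $D$ is continuous.
   Context: Let $\mathcal{A}$ and $\mathcal{B}$ be algebras (not assumed unital), let $\mathcal{M}$ be a $\mathcal{B}$-bimodule and let $\sigma, \tau: \mathcal{A} \rightarrow \mathcal{B}$ be mappings (not assumed linear). A linear mapping $D:\mathcal{A} \rightarrow \mathcal{M}$ is called a generalized $(\sigma, \tau)$-derivation associated with a linear mapping $d:\mathcal{A} \rightarrow \mathcal{M}$ if $D(ab) = D(a)\sigma(b) + \tau(a) d(b)$ for all $a, b \in \mathcal{A}$, where the products on the right are the right and left module actions of $\mathcal{B}$ on $\mathcal{M}$. (The mapping $d$ is not assumed to be a $(\sigma,\tau)$-derivation.) A Banach $\mathcal{B}$-bimodule is a Banach space that is a $\mathcal{B}$-bimodule with bounded (jointly continuous) bilinear left and right module actions. *)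

theory Defs
  imports "HOL-Analysis.Analysis"
begin

text \<open>All vector spaces and algebras are over the complex numbers, and algebras need not be
  unital.  The library's normed classes are over the reals, so complex scalar multiplication is
  added on top of them, compatibly with the real one.\<close>

class complex_vector = real_vector +
  fixes scaleC :: "complex \<Rightarrow> 'a \<Rightarrow> 'a" (infixr "*\<^sub>C" 75)
  assumes scaleC_add_right: "c *\<^sub>C (x + y) = c *\<^sub>C x + c *\<^sub>C y"
    and scaleC_add_left: "(b + c) *\<^sub>C x = b *\<^sub>C x + c *\<^sub>C x"
    and scaleC_scaleC: "b *\<^sub>C c *\<^sub>C x = (b * c) *\<^sub>C x"
    and scaleC_one: "1 *\<^sub>C x = x"
    and scaleC_of_real: "complex_of_real r *\<^sub>C x = r *\<^sub>R x"

global_interpretation complex_vector: vector_space "scaleC :: complex \<Rightarrow> 'a::complex_vector \<Rightarrow> 'a"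
  by unfold_locales (simp_all add: scaleC_add_right scaleC_add_left scaleC_scaleC scaleC_one)

abbreviation clinear :: "('a::complex_vector \<Rightarrow> 'b::complex_vector) \<Rightarrow> bool" where
  "clinear \<equiv> Vector_Spaces.linear scaleC scaleC"

class complex_algebra = complex_vector + real_algebra +
  assumes mult_scaleC_left: "(c *\<^sub>C x) * y = c *\<^sub>C (x * y)"
    and mult_scaleC_right: "x * (c *\<^sub>C y) = c *\<^sub>C (x * y)"

class complex_normed_vector = complex_vector + real_normed_vector +
  assumes norm_scaleC: "norm (c *\<^sub>C x) = cmod c * norm x"

class complex_banach_space = complex_normed_vector + banach

class complex_banach_algebra = complex_banach_space + complex_algebra + real_normed_algebra

class cstar_algebra = complex_banach_algebra +
  fixes star :: "'a \<Rightarrow> 'a"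
  assumes star_star: "star (star x) = x"
    and star_add: "star (x + y) = star x + star y"
    and star_scaleC: "star (c *\<^sub>C x) = cnj c *\<^sub>C star x"
    and star_mult: "star (x * y) = star y * star x"
    and cstar_identity: "norm (star x * x) = (norm x)\<^sup>2"

instantiation complex :: cstar_algebra
begin

definition scaleC_complex :: "complex \<Rightarrow> complex \<Rightarrow> complex" where
  "scaleC_complex c x = c * x"

definition star_complex :: "complex \<Rightarrow> complex" where
  "star_complex = cnj"

instance
  by standard
    (simp_all add: scaleC_complex_def star_complex_def algebra_simps scaleR_conv_of_real
      norm_mult power2_eq_square)

end

locale bimodule =
  fixes lact :: "'b::complex_algebra \<Rightarrow> 'm::complex_vector \<Rightarrow> 'm"
    and ract :: "'m \<Rightarrow> 'b \<Rightarrow> 'm"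
  assumes clinear_lact_left: "clinear (\<lambda>b. lact b x)"
    and clinear_lact_right: "clinear (\<lambda>x. lact b x)"
    and clinear_ract_left: "clinear (\<lambda>x. ract x b)"
    and clinear_ract_right: "clinear (\<lambda>b. ract x b)"
    and lact_mult: "lact (a * b) x = lact a (lact b x)"
    and ract_mult: "ract x (a * b) = ract (ract x a) b"
    and lact_ract: "lact a (ract x b) = ract (lact a x) b"

text \<open>The bounds on the actions are arbitrary constants; contractivity is not required.\<close>

locale banach_bimodule = bimodule lact ract
  for lact :: "'b::complex_banach_algebra \<Rightarrow> 'm::complex_banach_space \<Rightarrow> 'm"
    and ract :: "'m \<Rightarrow> 'b \<Rightarrow> 'm" +
  assumes bounded_bilinear_lact: "bounded_bilinear lact"
    and bounded_bilinear_ract: "bounded_bilinear ract"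

text \<open>Only \<open>D\<close> and \<open>d\<close> are linear: \<open>\<sigma>\<close> and \<open>\<tau>\<close> are arbitrary maps, and \<open>d\<close> satisfies no
  product rule of its own.\<close>

definition generalized_derivation ::
    "('b \<Rightarrow> 'm \<Rightarrow> 'm) \<Rightarrow> ('m \<Rightarrow> 'b \<Rightarrow> 'm) \<Rightarrow> ('a \<Rightarrow> 'b) \<Rightarrow> ('a \<Rightarrow> 'b) \<Rightarrow>
      ('a::complex_algebra \<Rightarrow> 'm::complex_vector) \<Rightarrow> ('a \<Rightarrow> 'm) \<Rightarrow> bool" where
  "generalized_derivation lact ract \<sigma> \<tau> D d \<longleftrightarrow>
    clinear D \<and> clinear d \<and>
    (\<forall>a b. D (a * b) = ract (D a) (\<sigma> b) + lact (\<tau> a) (d b))"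

end

theory Submission
  imports Defs "HOL-Computational_Algebra.Polynomial"
begin

text \<open>Put \<open>E a c = D a \<cdot> \<sigma> c\<close> and \<open>B a c = \<tau> a \<cdot> d c\<close>, so that \<open>D (a * c) = E a c + B a c\<close>.  Although
\<open>\<sigma>\<close> and \<open>\<tau>\<close> are arbitrary maps, each summand is the difference of \<open>D (a * c)\<close> and the other one;
hence \<open>E a c\<close> is linear in \<open>c\<close>, \<open>B a c\<close> is linear in \<open>a\<close>, and continuity of \<open>\<sigma>\<close> and \<open>\<tau>\<close> at zero
makes these linear maps bounded.  Let \<open>J\<close> be the set of all \<open>a\<close> for which \<open>c \<mapsto> D (a * c)\<close> is
bounded, that is, for which \<open>B a\<close> is bounded.  It is a right ideal, and it is closed by the
uniform boundedness principle.  If \<open>\<tau>\<close> is multiplicative against \<open>d\<close>, then \<open>B (b * a) c\<close> is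
\<open>\<tau> b \<cdot> B a c\<close>, so \<open>J\<close> is also a left ideal; the other alternative becomes this one when \<open>D\<close> is
replaced by \<open>D \<circ> star\<close>.  The theorem follows from two statements: \<open>D\<close> is bounded on \<open>J\<close>, and \<open>J\<close> is
the whole algebra.

For the first, a null sequence in \<open>J\<close> has a common left factor in \<open>J\<close>: it is \<open>y * w m\<close> with
\<open>y \<in> J\<close> and \<open>w\<close> bounded (\<open>null_sequence_factorization\<close>, Cohen's argument).  So \<open>D\<close> is bounded along
it, because \<open>c \<mapsto> D (y * c)\<close> is bounded.

For the second, a gliding hump argument (\<open>gliding_hump\<close>) shows that there are no sequences with
\<open>a n * b m \<in> J\<close> for \<open>n < m\<close> and \<open>a n * b n \<notin> J\<close>.  Equivalently, decreasing chains of right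
annihilators modulo \<open>J\<close> become stationary (\<open>stable_annihilator\<close>).  Suppose that \<open>J\<close> is proper and
calculate modulo \<open>J\<close>.  In a minimal nonzero right annihilator no selfadjoint element is a proper
zero divisor.  But continuous functions with disjoint supports give zero divisors, so the spectrum
of a selfadjoint element there is very small, and one finds a projection \<open>p\<close> for which every
\<open>p * k * p\<close> is a complex multiple of \<open>p\<close> (\<open>minimal_projection\<close>).  On the right ideal generated by
\<open>p\<close> the map \<open>D\<close> is unbounded, since \<open>p \<notin> J\<close>.  Chain stationarity gives a subspace \<open>V\<close> of this right
ideal on which \<open>D\<close> is unbounded and which is minimal among those cut out by annihilator
conditions.  For \<open>x \<in> V\<close> the product \<open>x * star y\<close> is a scalar multiple of \<open>p\<close> for \<open>y \<in> V\<close>, so the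
condition \<open>x * star y = 0\<close> has codimension at most one in \<open>V\<close> and \<open>D\<close> remains unbounded under it.
By minimality the condition holds on all of \<open>V\<close>; with \<open>y = x\<close> it gives \<open>x = 0\<close>.  Hence \<open>V \<subseteq> J\<close>,
where \<open>D\<close> is bounded: a contradiction (\<open>J_eq_UNIV\<close>).

The functional calculus rests on the estimate \<open>norm_opoly_le\<close>: a real polynomial in a
selfadjoint element of norm at most \<open>1/2\<close> is bounded in norm by the supremum of the polynomial on
\<open>[-1, 1]\<close>.\<close>

section \<open>Elementary facts about C*-algebras\<close>

lemma scaleC_scaleR: "c *\<^sub>C (r *\<^sub>R x) = r *\<^sub>R (c *\<^sub>C (x::'a::complex_vector))"
  by (simp add: scaleC_of_real[symmetric] scaleC_scaleC mult.commute)

lemma star_scaleR: "star (r *\<^sub>R x) = r *\<^sub>R star (x::'a::cstar_algebra)"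
  using star_scaleC[of "complex_of_real r" x] by (simp add: scaleC_of_real)

lemma norm_star: "norm (star x) = norm (x::'a::cstar_algebra)"
proof -
  have le: "norm y \<le> norm (star y)" for y :: 'a
  proof (cases "y = 0")
    case False
    have "norm y * norm y = norm (star y * y)"
      by (simp add: cstar_identity power2_eq_square)
    also have "\<dots> \<le> norm (star y) * norm y" by (rule norm_mult_ineq)
    finally show ?thesis using False by simp
  qed simp
  show ?thesis using le[of x] le[of "star x"] by (simp add: star_star)
qed

lemma bounded_linear_star: "bounded_linear (star :: 'a::cstar_algebra \<Rightarrow> 'a)"
  by (rule bounded_linear_intro[where K = 1]) (simp_all add: star_add star_scaleR norm_star)

lemmas star_zero = linear_simps(3)[OF bounded_linear_star]
lemmas star_diff = linear_simps(2)[OF bounded_linear_star]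

lemma cstar_identity': "norm (x * star x) = (norm (x::'a::cstar_algebra))\<^sup>2"
  using cstar_identity[of "star x"] by (simp add: star_star norm_star)

text \<open>There is no unit to test against; the element \<open>star (a - b)\<close> takes its place, by the C*-identity.\<close>

lemma eq_if_left_mult_eq:
  fixes a b :: "'a::cstar_algebra"
  assumes "\<And>y. a * y = b * y"
  shows "a = b"
  using cstar_identity'[of "a - b"] assms[of "star (a - b)"] by (simp add: algebra_simps)

lemma norm_le_if_left_mult_le:
  fixes a :: "'a::cstar_algebra"
  assumes "\<And>y. norm (a * y) \<le> c * norm y" and "c \<ge> 0"
  shows "norm a \<le> c"
proof (cases "a = 0")
  case False
  have "norm a * norm a \<le> c * norm a"
    using assms(1)[of "star a"] by (simp add: cstar_identity' norm_star power2_eq_square)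
  then show ?thesis using False by simp
qed (use assms in simp)

section \<open>Polynomials in a linear operator\<close>

text \<open>The constant term acts as a multiple of the identity operator.  In this way a polynomial with
nonzero constant term can be applied to an element of an algebra without a unit.\<close>

definition opoly :: "('v::real_vector \<Rightarrow> 'v) \<Rightarrow> real poly \<Rightarrow> 'v \<Rightarrow> 'v" where
  "opoly T P x = (\<Sum>k\<le>degree P. coeff P k *\<^sub>R (T ^^ k) x)"

lemma opoly_eq_sum:
  assumes "degree P \<le> n"
  shows "opoly T P x = (\<Sum>k\<le>n. coeff P k *\<^sub>R (T ^^ k) x)"
  unfolding opoly_def using assms
  by (intro sum.mono_neutral_left) (auto simp: coeff_eq_0)

lemma opoly_0 [simp]: "opoly T 0 x = 0"
  by (simp add: opoly_def)

lemma opoly_add: "opoly T (P + Q) x = opoly T P x + opoly T Q x"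
proof -
  let ?n = "max (degree P) (degree Q)"
  have "degree (P + Q) \<le> ?n" by (rule degree_add_le_max)
  then show ?thesis
    by (simp add: opoly_eq_sum[of _ ?n] scaleR_add_left sum.distrib)
qed

lemma opoly_smult: "opoly T (smult a P) x = a *\<^sub>R opoly T P x"
  by (simp add: opoly_eq_sum[of _ "degree P"] degree_smult_le scaleR_sum_right)

lemma opoly_diff: "opoly T (P - Q) x = opoly T P x - opoly T Q x"
  using opoly_add[of T P "smult (-1) Q" x] opoly_smult[of T "-1" Q x] by simp

lemma opoly_pCons:
  assumes "linear T"
  shows "opoly T (pCons a P) x = a *\<^sub>R x + T (opoly T P x)"
proof -
  have "opoly T (pCons a P) x = (\<Sum>k\<le>Suc (degree P). coeff (pCons a P) k *\<^sub>R (T ^^ k) x)"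
    by (rule opoly_eq_sum) (rule degree_pCons_le)
  also have "\<dots> = a *\<^sub>R x + (\<Sum>k\<le>degree P. coeff P k *\<^sub>R T ((T ^^ k) x))"
    by (subst sum.atMost_Suc_shift) simp
  finally show ?thesis
    by (simp add: opoly_def linear_sum[OF assms] linear_scale[OF assms])
qed

lemma linear_opoly:
  assumes "linear T"
  shows "linear (opoly T P)"
proof (induction P)
  case (pCons a P)
  show ?case
    by (rule linearI) (simp_all add: opoly_pCons[OF assms] linear_add[OF assms]
        linear_scale[OF assms] linear_add[OF pCons(2)] linear_scale[OF pCons(2)] algebra_simps)
qed (simp add: linear_iff)

lemma opoly_mult:
  assumes "linear T"
  shows "opoly T (P * Q) x = opoly T P (opoly T Q x)"
  by (induction P) (simp_all add: opoly_add opoly_smult opoly_pCons[OF assms])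

lemma opoly_commute:
  assumes "linear T"
  shows "opoly T P (T x) = T (opoly T P x)"
  using opoly_mult[OF assms, of "[:0, 1:]" P x] opoly_mult[OF assms, of P "[:0, 1:]" x]
  by (simp add: opoly_pCons[OF assms] mult.commute linear_0[OF assms])

lemma opoly_mem_subspace:
  assumes "subspace V" and "\<And>y. y \<in> V \<Longrightarrow> T y \<in> V" and "x \<in> V"
  shows "opoly T P x \<in> V"
proof -
  have "(T ^^ k) x \<in> V" for k by (induction k) (use assms in auto)
  then show ?thesis
    unfolding opoly_def by (intro subspace_sum subspace_scale assms(1))
qed

text \<open>The coefficients are averages of the values over roots of unity.\<close>

text \<open>The coefficient of \<open>z ^ k\<close> is the average of \<open>C(z) * z ^ -k\<close> over the \<open>N\<close>-th roots of unity, for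
any \<open>N\<close> larger than the degree.\<close>

lemma coeff_le_sup_unit_circle:
  fixes C :: "real poly"
  assumes "\<And>z. cmod z = 1 \<Longrightarrow> cmod (poly (map_poly of_real C) z) \<le> M"
  shows "\<bar>coeff C k\<bar> \<le> M"
proof (cases "k \<le> degree C")
  case False
  have "cmod (poly (map_poly of_real C) 1) \<le> M" using assms[of 1] by simp
  then show ?thesis using False by (simp add: coeff_eq_0) (meson norm_ge_zero order_trans)
next
  case True
  define n where "n = degree C"
  define N where "N = Suc n"
  \<comment> \<open>The roots of unity of order larger than the degree.\<close>
  define w where "w j = cis (2 * pi * real j / real N)" for j :: nat
  let ?p = "poly (map_poly of_real C) :: complex \<Rightarrow> complex"
  have N: "N > 0" by (simp add: N_def)
  have val: "?p z = (\<Sum>i\<le>n. of_real (coeff C i) * z ^ i)" for z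
    by (simp add: poly_altdef coeff_map_poly n_def degree_map_poly)
  have orth: "(\<Sum>j<N. w j ^ i * cnj (w j) ^ k) = (if i = k then of_nat N else 0)"
    if "i \<le> n" for i
  proof -
    have eq: "w j ^ i * cnj (w j) ^ k = cis (2 * pi * (real i - real k) / real N) ^ j" for j
      by (simp add: w_def Complex.DeMoivre cis_cnj cis_mult del: cis_divide)
         (simp add: algebra_simps add_divide_distrib diff_divide_distrib)
    show ?thesis
    proof (cases "i = k")
      case True
      then show ?thesis using eq by simp
    next
      case False
      define q where "q = cis (2 * pi * (real i - real k) / real N)"
      have "q \<noteq> 1"
      proof
        assume "q = 1"
        then obtain m :: int where "2 * pi * (real i - real k) / real N = of_int m * (2 * pi)"
          unfolding q_def cis_conv_exp exp_eq_1 by auto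
        then have "pi * (real i - real k) = pi * (of_int m * real N)"
          using N by (simp add: field_simps)
        then have "real i - real k = of_int m * real N"
          by (simp only: mult_left_cancel[OF pi_neq_zero])
        then have "of_int (int i - int k) = (of_int (m * int N) :: real)" by simp
        then have m: "int i - int k = m * int N" by (simp only: of_int_eq_iff)
        then have "int N dvd int i - int k" by simp
        moreover have "int i - int k \<noteq> 0" using False by simp
        ultimately have "\<bar>int N\<bar> \<le> \<bar>int i - int k\<bar>" by (intro dvd_imp_le_int)
        then have "N \<le> max i k" by linarith
        then show False using \<open>i \<le> n\<close> True unfolding N_def n_def by linarith
      qed
      moreover have "q ^ N = 1"
      proof -
        have "q ^ N = cis (2 * pi * (real i - real k))"
          using N by (simp add: q_def Complex.DeMoivre)
        also have "\<dots> = cis (2 * pi * of_int (int i - int k))" by simp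
        also have "\<dots> = 1" by (rule cis_multiple_2pi) simp
        finally show ?thesis .
      qed
      ultimately show ?thesis
        using False by (simp add: eq q_def[symmetric] geometric_sum)
    qed
  qed
  have "(\<Sum>j<N. ?p (w j) * cnj (w j) ^ k)
      = (\<Sum>i\<le>n. of_real (coeff C i) * (\<Sum>j<N. w j ^ i * cnj (w j) ^ k))"
    unfolding val sum_distrib_right sum_distrib_left
    by (subst sum.swap) (simp add: mult_ac)
  also have "\<dots> = (\<Sum>i\<le>n. if i = k then of_real (coeff C i) * of_nat N else 0)"
    by (rule sum.cong) (auto simp: orth)
  also have "\<dots> = of_real (coeff C k) * of_nat N"
    using True by (simp add: n_def)
  finally have eq: "(\<Sum>j<N. ?p (w j) * cnj (w j) ^ k) = of_real (coeff C k) * of_nat N" .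
  have "\<bar>coeff C k\<bar> * real N = cmod (\<Sum>j<N. ?p (w j) * cnj (w j) ^ k)"
    unfolding eq by (simp add: norm_mult)
  also have "\<dots> \<le> (\<Sum>j<N. M)"
    by (rule sum_norm_le) (use assms in \<open>simp add: norm_mult norm_power w_def\<close>)
  finally show ?thesis using N by (simp add: mult.commute)
qed

section \<open>Polynomials in a selfadjoint element\<close>

text \<open>The bound \<open>1/2\<close> leaves room for the contraction that produces the square root of \<open>1 - h\<^sup>2\<close>; other
selfadjoint elements are rescaled.\<close>

locale small_selfadjoint =
  fixes h :: "'a::cstar_algebra"
  assumes selfadjoint: "star h = h" and norm_h: "norm h \<le> 1/2"
begin

text \<open>Formally \<open>g = 1 - sqrt (1 - h\<^sup>2)\<close>, an element of the algebra even when the algebra has no unit: the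
last equation is \<open>(1 - g)\<^sup>2 = 1 - h\<^sup>2\<close> multiplied out, and it is a fixed-point equation for a
contraction of the ball of radius \<open>1/2\<close>.\<close>

lemma ex_one_minus_sqrt:
  "\<exists>g. star g = g \<and> g * h = h * g \<and> (1/2) *\<^sub>R (h * h + g * g) = g"
proof -
  define S where "S = {g. star g = g \<and> g * h = h * g \<and> norm g \<le> 1/2}"
  let ?f = "\<lambda>g. (1/2) *\<^sub>R (h * h + g * g)"
  have hh: "norm (h * h) \<le> 1/4"
    using mult_mono[OF norm_h norm_h] norm_mult_ineq[of h h] by simp
  have "closed S"
    unfolding S_def
    by (intro closed_Collect_conj closed_Collect_eq closed_Collect_le continuous_intros
        linear_continuous_on bounded_linear_star)
  then have "complete S" by (simp add: complete_eq_closed)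
  moreover have "0 \<in> S" by (simp add: S_def star_zero)
  moreover have "?f g \<in> S" if "g \<in> S" for g
  proof -
    have g: "star g = g" "g * h = h * g" "norm g \<le> 1/2" using that by (auto simp: S_def)
    have "norm (g * g) \<le> 1/4"
      using mult_mono[OF g(3) g(3)] norm_mult_ineq[of g g] by simp
    then have "norm (?f g) \<le> 1/2"
      using norm_triangle_ineq[of "h * h" "g * g"] hh by simp
    moreover have "g * g * h = h * (g * g)"
      by (metis g(2) mult.assoc)
    ultimately show ?thesis
      by (simp add: S_def star_scaleR star_add star_mult g(1) selfadjoint algebra_simps)
  qed
  moreover have "dist (?f x) (?f y) \<le> 1/2 * dist x y" if "x \<in> S" "y \<in> S" for x y
  proof -
    have xy: "norm x \<le> 1/2" "norm y \<le> 1/2" using that by (auto simp: S_def)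
    have "x * x - y * y = x * (x - y) + (x - y) * y" by (simp add: algebra_simps)
    then have "norm (x * x - y * y) \<le> norm x * norm (x - y) + norm (x - y) * norm y"
      by (metis norm_triangle_mono norm_mult_ineq)
    also have "\<dots> \<le> 1/2 * norm (x - y) + norm (x - y) * (1/2)"
      by (intro add_mono mult_right_mono mult_left_mono xy) auto
    finally have "norm (x * x - y * y) \<le> norm (x - y)" by simp
    moreover have "?f x - ?f y = (1/2) *\<^sub>R (x * x - y * y)" by (simp add: algebra_simps)
    ultimately show ?thesis by (simp add: dist_norm)
  qed
  ultimately have "\<exists>!x\<in>S. ?f x = x"
    by (intro Banach_fix[of S "1/2"]) auto
  then show ?thesis by (auto simp: S_def)
qed

definition g where
  "g = (SOME g. star g = g \<and> g * h = h * g \<and> (1/2) *\<^sub>R (h * h + g * g) = g)"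

lemma g: "star g = g" "g * h = h * g" "h * h + g * g = 2 *\<^sub>R g"
proof -
  have "star g = g \<and> g * h = h * g \<and> (1/2) *\<^sub>R (h * h + g * g) = g"
    unfolding g_def by (rule someI_ex) (rule ex_one_minus_sqrt)
  then show "star g = g" "g * h = h * g" "h * h + g * g = 2 *\<^sub>R g"
    by (auto dest!: arg_cong[of "(1/2) *\<^sub>R (h * h + g * g)" _ "\<lambda>x. 2 *\<^sub>R x"])
qed

text \<open>Left multiplication by \<open>h + c * sqrt (1 - h\<^sup>2)\<close>.  For \<open>c = \<i>\<close> this is a unitary operator \<open>U\<close> with
inverse \<open>rot (- \<i>)\<close>, and \<open>h\<close> is its real part \<open>(U + U\<^sup>-\<^sup>1) / 2\<close>.\<close>

definition rot where
  "rot c x = h * x + c *\<^sub>C (x - g * x)"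

abbreviation U where "U \<equiv> rot \<i>"

lemma linear_rot: "linear (rot c)"
proof (rule linearI)
  fix r x
  show "rot c (r *\<^sub>R x) = r *\<^sub>R rot c x"
    by (simp add: rot_def scaleC_scaleR scaleR_add_right flip: scaleR_diff_right)
qed (simp add: rot_def algebra_simps scaleC_add_right complex_vector.scale_right_diff_distrib)

lemma rot_rot:
  assumes "c * c = -1"
  shows "rot c (rot (- c) x) = x"
proof -
  have ghx: "g * (h * x) = h * (g * x)" by (metis g(2) mult.assoc)
  have ggx: "g * (g * x) = g * x + g * x - h * (h * x)"
    using g(3) by (metis (no_types) add_diff_cancel_left' mult.assoc distrib_right scaleR_2)
  show ?thesis
    by (simp add: rot_def right_diff_distrib distrib_left mult_scaleC_right scaleC_add_right
        complex_vector.scale_right_diff_distrib scaleC_scaleC assms scaleC_one ghx ggx)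
qed

lemma star_rot_mult: "star (rot c x) * y = star x * rot (cnj c) y"
  by (simp add: rot_def star_add star_mult star_scaleC star_diff selfadjoint g(1)
      distrib_left distrib_right left_diff_distrib right_diff_distrib
      mult_scaleC_left mult_scaleC_right mult.assoc)

lemma norm_U: "norm (U x) = norm x"
proof -
  have "(norm (U x))\<^sup>2 = norm (star x * rot (- \<i>) (U x))"
    by (simp add: star_rot_mult flip: cstar_identity)
  also have "\<dots> = (norm x)\<^sup>2"
    using rot_rot[of "- \<i>" x] by (simp add: cstar_identity)
  finally show ?thesis by simp
qed

lemma U_mult_h: "U (h * x) = (1/2) *\<^sub>R (x + U (U x))"
proof -
  have "2 *\<^sub>R (h * x) = U x + rot (- \<i>) x"
    by (simp add: rot_def scaleR_2)
  then have "U (2 *\<^sub>R (h * x)) = U (U x) + x"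
    using rot_rot[of \<i> x] by (simp add: linear_add[OF linear_rot])
  then have "(1/2) *\<^sub>R (2 *\<^sub>R U (h * x)) = (1/2) *\<^sub>R (x + U (U x))"
    by (simp only: linear_scale[OF linear_rot] add.commute)
  then show ?thesis by simp
qed

lemma linear_U_power: "linear (U ^^ n)"
proof (induction n)
  case 0
  show ?case using linear_id by (simp add: id_def)
next
  case (Suc n)
  show ?case using linear_compose[OF Suc linear_rot[of \<i>]] by (simp add: o_def)
qed

lemma linear_left_mult: "linear (\<lambda>x. h * x)"
  by (intro bounded_linear.linear bounded_linear_mult_right)

text \<open>The substitution \<open>h = (U + inverse U) / 2\<close> turns a polynomial of degree at most \<open>n\<close> in \<open>h\<close> into a Laurent
polynomial in \<open>U\<close>, which the factor \<open>U ^ n\<close> clears of negative powers.  The same recursion for a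
complex number \<open>z\<close> in place of \<open>U\<close> records what the coefficients of \<open>C\<close> mean.\<close>

lemma opoly_unitary:
  assumes "degree P \<le> n"
  shows "\<exists>C. degree C \<le> 2 * n \<and>
    (\<forall>x. (U ^^ n) (opoly (\<lambda>y. h * y) P x) = opoly U C x) \<and>
    (\<forall>z. z \<noteq> 0 \<longrightarrow> poly (map_poly complex_of_real C) z =
       z ^ n * poly (map_poly complex_of_real P) ((z + inverse z) / 2))"
  using assms
proof (induction n arbitrary: P)
  case 0
  then obtain a where P: "P = [:a:]" by (metis degree_eq_zeroE le_zero_eq)
  have "opoly T P x = a *\<^sub>R x" for T :: "'a \<Rightarrow> 'a" and x
    by (simp add: P opoly_def)
  then show ?case by (intro exI[of _ P]) (simp add: P map_poly_pCons)
next
  case (Suc n)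
  obtain a Q where P: "P = pCons a Q" by (cases P)
  have "degree Q \<le> n" using Suc.prems by (simp add: P split: if_splits)
  then obtain C where C: "degree C \<le> 2 * n"
    "\<And>x. (U ^^ n) (opoly (\<lambda>y. h * y) Q x) = opoly U C x"
    "\<And>z. z \<noteq> 0 \<Longrightarrow> poly (map_poly complex_of_real C) z =
       z ^ n * poly (map_poly complex_of_real Q) ((z + inverse z) / 2)"
    using Suc.IH[of Q] by blast
  let ?C = "monom a (Suc n) + smult (1/2) ([:1, 0, 1:] * C)"
  have mp: "map_poly complex_of_real ?C =
      monom (of_real a) (Suc n) + smult (1/2) ([:1, 0, 1:] * map_poly of_real C)"
    by (rule poly_eqI) (simp add: coeff_map_poly coeff_pCons split: nat.split)
  have "degree ?C \<le> 2 * Suc n"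
  proof (intro degree_add_le)
    have "degree ([:1, 0, 1:] * C) \<le> degree [:1, 0, 1 :: real:] + degree C"
      by (rule degree_mult_le)
    also have "\<dots> \<le> 2 * Suc n" using C(1) by simp
    finally show "degree (smult (1/2) ([:1, 0, 1:] * C)) \<le> 2 * Suc n" by simp
  qed (use degree_monom_le[of a "Suc n"] in simp)
  moreover have "(U ^^ Suc n) (opoly (\<lambda>y. h * y) P x) = opoly U ?C x" for x
  proof -
    let ?w = "opoly (\<lambda>y. h * y) Q x"
    have m: "opoly U (monom a (Suc n)) x = a *\<^sub>R (U ^^ Suc n) x"
      by (subst opoly_eq_sum[OF degree_monom_le])
         (simp add: if_distrib[of "\<lambda>r. r *\<^sub>R _"] cong: if_cong)
    have q: "opoly U [:1, 0, 1:] y = y + U (U y)" for y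
      by (simp add: opoly_pCons linear_rot linear_0[OF linear_rot])
    have "(U ^^ Suc n) (opoly (\<lambda>y. h * y) P x) = (U ^^ Suc n) (a *\<^sub>R x + h * ?w)"
      by (simp add: P opoly_pCons linear_left_mult)
    also have "\<dots> = a *\<^sub>R (U ^^ Suc n) x + (U ^^ n) (U (h * ?w))"
      by (simp only: linear_add[OF linear_U_power] linear_scale[OF linear_U_power] linear_add[OF linear_rot]
          linear_scale[OF linear_rot] funpow_Suc_right o_def)
    also have "(U ^^ n) (U (h * ?w)) = (1/2) *\<^sub>R ((U ^^ n) ?w + (U ^^ n) (U (U ?w)))"
      by (simp only: U_mult_h linear_add[OF linear_U_power] linear_scale[OF linear_U_power])
    also have "(U ^^ n) (U (U ?w)) = U (U ((U ^^ n) ?w))"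
      by (simp only: funpow_swap1)
    finally show ?thesis
      by (simp only: C(2) opoly_add opoly_smult opoly_mult[OF linear_rot] m q)
  qed
  moreover have "poly (map_poly complex_of_real ?C) z =
       z ^ Suc n * poly (map_poly complex_of_real P) ((z + inverse z) / 2)" if "z \<noteq> 0" for z
    unfolding mp using that
    by (simp add: P C(3) poly_monom map_poly_pCons field_simps power2_eq_square)
  ultimately show ?case by blast
qed

text \<open>Since \<open>U\<close> is isometric, the norm is at most the sum of the absolute values of the \<open>2 * n + 1\<close>
coefficients of \<open>C\<close>.  On the unit circle \<open>(z + inverse z) / 2\<close> is the real part of \<open>z\<close>, so \<open>C\<close> is
bounded there by \<open>M\<close>.\<close>

lemma norm_opoly_degree_bound:
  assumes "degree P \<le> n" and "\<And>t. \<bar>t\<bar> \<le> 1 \<Longrightarrow> \<bar>poly P t\<bar> \<le> M"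
  shows "norm (opoly (\<lambda>y. h * y) P x) \<le> (2 * n + 1) * M * norm x"
proof -
  obtain C where C: "degree C \<le> 2 * n"
    "\<And>x. (U ^^ n) (opoly (\<lambda>y. h * y) P x) = opoly U C x"
    "\<And>z. z \<noteq> 0 \<Longrightarrow> poly (map_poly complex_of_real C) z =
       z ^ n * poly (map_poly complex_of_real P) ((z + inverse z) / 2)"
    using opoly_unitary[OF assms(1)] by blast
  have U_power: "norm ((U ^^ k) y) = norm y" for k y
    by (induction k) (simp_all add: norm_U)
  have "cmod (poly (map_poly of_real C) z) \<le> M" if z: "cmod z = 1" for z
  proof -
    have "z \<noteq> 0" using z by auto
    have "z * cnj z = 1" using z complex_norm_square[of z] by simp
    then have "inverse z = cnj z" by (rule inverse_unique)
    then have "(z + inverse z) / 2 = of_real (Re z)" by (simp add: complex_eq_iff)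
    moreover have "poly (map_poly complex_of_real P) (of_real t) = of_real (poly P t)" for t
      by (induction P) (simp_all add: map_poly_pCons)
    ultimately have "cmod (poly (map_poly of_real C) z) = \<bar>poly P (Re z)\<bar>"
      using C(3)[OF \<open>z \<noteq> 0\<close>] z by (simp add: norm_mult norm_power)
    then show ?thesis using assms(2)[of "Re z"] abs_Re_le_cmod[of z] z by simp
  qed
  then have coeff: "\<bar>coeff C k\<bar> \<le> M" for k by (rule coeff_le_sup_unit_circle)
  have "norm (opoly (\<lambda>y. h * y) P x) = norm (opoly U C x)"
    using C(2)[of x] U_power[of n "opoly (\<lambda>y. h * y) P x"] by simp
  also have "\<dots> \<le> (\<Sum>k\<le>2 * n. M * norm x)"
    unfolding opoly_eq_sum[OF C(1)]
    by (rule sum_norm_le) (simp add: U_power mult_right_mono coeff)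
  finally show ?thesis by (simp add: algebra_simps)
qed

lemma star_opoly_mult: "star (opoly (\<lambda>y. h * y) P x) * y = star x * opoly (\<lambda>y. h * y) P y"
proof (induction P arbitrary: y)
  case (pCons a P)
  have "star (h * opoly (\<lambda>y. h * y) P x) * y = star (opoly (\<lambda>y. h * y) P x) * (h * y)"
    by (simp add: star_mult selfadjoint mult.assoc)
  also have "\<dots> = star x * (h * opoly (\<lambda>y. h * y) P y)"
    by (simp add: pCons.IH opoly_commute[OF linear_left_mult])
  finally show ?case
    by (simp add: opoly_pCons linear_left_mult star_add star_scaleR distrib_left distrib_right)
qed (simp add: star_zero)

text \<open>The operator \<open>P(h)\<close> is symmetric, so the C*-identity gives \<open>norm (P(h) x) ^ 2 \<le> norm x * norm (P(h)\<^sup>2 x)\<close>,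
and this can be iterated.\<close>

lemma power_norm_opoly_le:
  "norm (opoly (\<lambda>y. h * y) P x) ^ (2 ^ m) * norm x
    \<le> norm x ^ (2 ^ m) * norm (opoly (\<lambda>y. h * y) (P ^ (2 ^ m)) x)"
proof (induction m)
  case (Suc m)
  let ?N = "\<lambda>m. norm (opoly (\<lambda>y. h * y) (P ^ (2 ^ m)) x)"
  have "?N m ^ 2 = norm (star (opoly (\<lambda>y. h * y) (P ^ 2 ^ m) x) * opoly (\<lambda>y. h * y) (P ^ 2 ^ m) x)"
    by (simp add: cstar_identity)
  also have "\<dots> = norm (star x * opoly (\<lambda>y. h * y) (P ^ 2 ^ Suc m) x)"
    by (simp add: star_opoly_mult opoly_mult[OF linear_left_mult, symmetric] power_add[symmetric] mult_2)
  also have "\<dots> \<le> norm x * ?N (Suc m)"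
    using norm_mult_ineq[of "star x"] by (simp add: norm_star)
  finally have N: "?N m ^ 2 \<le> norm x * ?N (Suc m)" .
  show ?case
  proof (cases "x = 0")
    case False
    let ?p = "norm (opoly (\<lambda>y. h * y) P x)"
    have "?p ^ (2 ^ Suc m) * norm x * norm x = (?p ^ 2 ^ m * norm x) ^ 2"
      by (simp add: power2_eq_square power_add[symmetric] mult_2 mult_ac)
    also have "\<dots> \<le> (norm x ^ 2 ^ m * ?N m) ^ 2" by (rule power_mono[OF Suc.IH]) simp
    also have "\<dots> = norm x ^ 2 ^ Suc m * ?N m ^ 2"
      by (simp add: power2_eq_square power_add[symmetric] mult_2 mult_ac)
    also have "\<dots> \<le> norm x ^ 2 ^ Suc m * (norm x * ?N (Suc m))"
      by (rule mult_left_mono[OF N]) simp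
    finally show ?thesis using False by (simp add: mult_ac)
  qed simp
qed simp

text \<open>Applied to \<open>P ^ (2 ^ m)\<close>, the degree-dependent bound loses only a factor that is linear in \<open>2 ^ m\<close>, which
disappears when the \<open>2 ^ m\<close>-th root is taken.\<close>

lemma norm_opoly_le:
  assumes "\<And>t. \<bar>t\<bar> \<le> 1 \<Longrightarrow> \<bar>poly P t\<bar> \<le> M"
  shows "norm (opoly (\<lambda>y. h * y) P x) \<le> M * norm x"
proof (rule ccontr)
  assume contr: "\<not> ?thesis"
  let ?p = "norm (opoly (\<lambda>y. h * y) P x)"
  have M: "M \<ge> 0" using assms[of 0] by simp
  have "x \<noteq> 0" using contr linear_0[OF linear_opoly[OF linear_left_mult]] by auto
  have lt: "M * norm x < ?p" using contr by simp
  define n where "n = degree P"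
  have b: "?p ^ (2 ^ m) \<le> (2 * (2 ^ m * n) + 1) * (M * norm x) ^ (2 ^ m)" for m
  proof -
    have "degree (P ^ 2 ^ m) \<le> 2 ^ m * n"
      using degree_power_le[of P "2 ^ m"] by (simp add: n_def mult.commute)
    moreover have "\<bar>poly (P ^ 2 ^ m) t\<bar> \<le> M ^ 2 ^ m" if "\<bar>t\<bar> \<le> 1" for t
      using power_mono[OF assms[OF that]] by (simp add: power_abs)
    ultimately have "norm (opoly (\<lambda>y. h * y) (P ^ 2 ^ m) x)
        \<le> (2 * real (2 ^ m * n) + 1) * M ^ 2 ^ m * norm x"
      by (rule norm_opoly_degree_bound)
    then have "norm x ^ (2 ^ m) * norm (opoly (\<lambda>y. h * y) (P ^ (2 ^ m)) x)
      \<le> norm x ^ (2 ^ m) * ((2 * real (2 ^ m * n) + 1) * M ^ 2 ^ m * norm x)"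
      by (rule mult_left_mono) simp
    with power_norm_opoly_le[of P x m]
    have "?p ^ (2 ^ m) * norm x \<le> (2 * (2 ^ m * n) + 1) * (M * norm x) ^ (2 ^ m) * norm x"
      by (simp add: power_mult_distrib mult_ac add_ac)
    then show ?thesis using \<open>x \<noteq> 0\<close> by simp
  qed
  define N where "N m = (2::nat) ^ m" for m
  have p: "?p > 0" using lt M by (meson le_less_trans mult_nonneg_nonneg norm_ge_zero)
  define r where "r = M * norm x / ?p"
  have r: "0 \<le> r" "r < 1" using lt p M by (auto simp: r_def)
  have "1 \<le> (2 * (real (N m) * n) + 1) * r ^ N m" for m
    using b[of m] p by (simp add: r_def power_divide N_def field_simps)
  moreover have "(\<lambda>m. (2 * (real (N m) * n) + 1) * r ^ N m) \<longlonglongrightarrow> 0"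
  proof -
    have "(\<lambda>k. 2 * n * (real k * r ^ k) + r ^ k) \<longlonglongrightarrow> real (2 * n) * 0 + 0"
      using r by (intro tendsto_intros powser_times_n_limit_0 LIMSEQ_power_zero) auto
    then have "(\<lambda>k. (2 * (real k * n) + 1) * r ^ k) \<longlonglongrightarrow> 0" by (simp add: algebra_simps)
    moreover have "strict_mono N" by (rule strict_monoI) (simp add: N_def)
    ultimately show ?thesis using LIMSEQ_subseq_LIMSEQ by (fastforce simp: o_def)
  qed
  ultimately have "1 \<le> (0::real)" by (meson LIMSEQ_le_const)
  then show False by simp
qed

end

section \<open>Continuous functional calculus\<close>

lemma Weierstrass_poly:
  assumes "continuous_on {-1..1::real} f" and "e > 0"
  shows "\<exists>P. \<forall>t. \<bar>t\<bar> \<le> 1 \<longrightarrow> \<bar>poly P t - f t\<bar> \<le> e"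
proof -
  obtain p where p: "real_polynomial_function p" "\<And>t. t \<in> {-1..1} \<Longrightarrow> \<bar>f t - p t\<bar> < e"
    using Stone_Weierstrass_real_polynomial_function[OF compact_Icc assms] by blast
  obtain a n where "p = (\<lambda>t. \<Sum>i\<le>n. a i * t ^ i)"
    using p(1) by (auto simp: real_polynomial_function_iff_sum)
  then have "poly (\<Sum>i\<le>n. monom (a i) i) t = p t" for t
    by (simp add: poly_sum poly_monom)
  then show ?thesis
    using p(2) by (intro exI[of _ "\<Sum>i\<le>n. monom (a i) i"])
      (force simp: abs_minus_commute abs_le_iff intro: less_imp_le)
qed

lemma Weierstrass_poly_sequence:
  assumes "continuous_on {-1..1::real} f"
  shows "\<exists>P. \<forall>n t. \<bar>t\<bar> \<le> 1 \<longrightarrow> \<bar>poly (P n) t - f t\<bar> \<le> inverse (real (Suc n))"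
  using Weierstrass_poly[OF assms, of "inverse (real (Suc n))" for n]
  by (intro choice) simp

lemma continuous_bounded:
  assumes "continuous_on {-1..1::real} f"
  obtains B :: real where "B \<ge> 0" "\<And>t. \<bar>t\<bar> \<le> 1 \<Longrightarrow> \<bar>f t\<bar> \<le> B"
proof -
  have "bounded (f ` {-1..1})"
    using compact_continuous_image[OF assms] compact_imp_bounded by blast
  then obtain B where "B > 0" "\<forall>y\<in>f ` {-1..1}. norm y \<le> B" unfolding bounded_pos by blast
  then show ?thesis by (intro that[of B]) (auto simp: abs_le_iff)
qed

context small_selfadjoint
begin

abbreviation pcalc where "pcalc \<equiv> opoly (\<lambda>y. h * y)"

lemmas linear_pcalc = linear_opoly[OF linear_left_mult]

text \<open>\<open>fcalc f x\<close> is \<open>f(h) x\<close>.  The operator \<open>f(h)\<close> exists for every continuous \<open>f\<close>, also when \<open>f 0\<close> is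
not zero and \<open>f(h)\<close> is not an element of the algebra; \<open>fcalc f h\<close> is the element obtained from
the function \<open>t \<mapsto> f t * t\<close>.  For continuous \<open>f\<close> the defining property makes the choice unique and independent of the
approximating polynomials.\<close>

definition fcalc :: "(real \<Rightarrow> real) \<Rightarrow> 'a \<Rightarrow> 'a" where
  "fcalc f x = (SOME y. \<forall>P e. (\<forall>t. \<bar>t\<bar> \<le> 1 \<longrightarrow> \<bar>poly P t - f t\<bar> \<le> e) \<longrightarrow>
     norm (pcalc P x - y) \<le> e * norm x)"

lemma norm_pcalc_diff_le:
  assumes "\<And>t. \<bar>t\<bar> \<le> 1 \<Longrightarrow> \<bar>poly P t - f t\<bar> \<le> e" and "\<And>t. \<bar>t\<bar> \<le> 1 \<Longrightarrow> \<bar>poly Q t - f t\<bar> \<le> e'"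
  shows "norm (pcalc P x - pcalc Q x) \<le> (e + e') * norm x"
proof -
  have "\<bar>poly (P - Q) t\<bar> \<le> e + e'" if "\<bar>t\<bar> \<le> 1" for t
    using assms(1)[OF that] assms(2)[OF that] by simp
  then show ?thesis using norm_opoly_le by (metis opoly_diff)
qed

lemma norm_pcalc_minus_fcalc_le:
  assumes "continuous_on {-1..1} f" and "\<And>t. \<bar>t\<bar> \<le> 1 \<Longrightarrow> \<bar>poly P t - f t\<bar> \<le> e"
  shows "norm (pcalc P x - fcalc f x) \<le> e * norm x"
proof -
  obtain Q where Q: "\<And>n t. \<bar>t\<bar> \<le> 1 \<Longrightarrow> \<bar>poly (Q n) t - f t\<bar> \<le> inverse (real (Suc n))"
    using Weierstrass_poly_sequence[OF assms(1)] by blast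
  let ?r = "\<lambda>n. inverse (real (Suc n))"
  have "Cauchy (\<lambda>n. pcalc (Q n) x)"
  proof (rule CauchyI)
    fix \<epsilon> :: real assume "\<epsilon> > 0"
    have "(\<lambda>n. (?r n + ?r n) * norm x) \<longlonglongrightarrow> (0 + 0) * norm x"
      by (intro tendsto_intros LIMSEQ_inverse_real_of_nat)
    then have "eventually (\<lambda>n. (?r n + ?r n) * norm x < \<epsilon>) sequentially"
      using \<open>\<epsilon> > 0\<close> by (intro order_tendstoD) auto
    then obtain N where N: "(?r N + ?r N) * norm x < \<epsilon>" by (auto simp: eventually_sequentially)
    have "norm (pcalc (Q m) x - pcalc (Q n) x) < \<epsilon>" if "m \<ge> N" "n \<ge> N" for m n
    proof -
      have "norm (pcalc (Q m) x - pcalc (Q n) x) \<le> (?r m + ?r n) * norm x"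
        by (rule norm_pcalc_diff_le[OF Q Q])
      also have "\<dots> \<le> (?r N + ?r N) * norm x"
        using that by (intro mult_right_mono add_mono) (auto intro!: le_imp_inverse_le)
      finally show ?thesis using N by simp
    qed
    then show "\<exists>N. \<forall>m\<ge>N. \<forall>n\<ge>N. norm (pcalc (Q m) x - pcalc (Q n) x) < \<epsilon>" by blast
  qed
  then obtain y where y: "(\<lambda>n. pcalc (Q n) x) \<longlonglongrightarrow> y"
    using Cauchy_convergent convergent_def by blast
  have "norm (pcalc P x - y) \<le> e * norm x" if P: "\<And>t. \<bar>t\<bar> \<le> 1 \<Longrightarrow> \<bar>poly P t - f t\<bar> \<le> e" for P e
  proof (rule LIMSEQ_le)
    show "(\<lambda>n. norm (pcalc P x - pcalc (Q n) x)) \<longlonglongrightarrow> norm (pcalc P x - y)"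
      by (intro tendsto_intros y)
    have "(\<lambda>n. (e + ?r n) * norm x) \<longlonglongrightarrow> (e + 0) * norm x"
      by (intro tendsto_intros LIMSEQ_inverse_real_of_nat)
    then show "(\<lambda>n. (e + ?r n) * norm x) \<longlonglongrightarrow> e * norm x" by simp
    show "\<exists>N. \<forall>n\<ge>N. norm (pcalc P x - pcalc (Q n) x) \<le> (e + ?r n) * norm x"
      using norm_pcalc_diff_le[OF P Q] by blast
  qed
  then have "\<exists>y. \<forall>P e. (\<forall>t. \<bar>t\<bar> \<le> 1 \<longrightarrow> \<bar>poly P t - f t\<bar> \<le> e) \<longrightarrow> norm (pcalc P x - y) \<le> e * norm x"
    by blast
  then have "\<forall>P e. (\<forall>t. \<bar>t\<bar> \<le> 1 \<longrightarrow> \<bar>poly P t - f t\<bar> \<le> e) \<longrightarrow>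
     norm (pcalc P x - fcalc f x) \<le> e * norm x"
    unfolding fcalc_def by (rule someI_ex)
  then show ?thesis using assms(2) by blast
qed

lemma fcalc_tendsto:
  assumes "continuous_on {-1..1} f" and "e \<longlonglongrightarrow> 0"
    and "\<And>n t. \<bar>t\<bar> \<le> 1 \<Longrightarrow> \<bar>poly (P n) t - f t\<bar> \<le> e n"
  shows "(\<lambda>n. pcalc (P n) x) \<longlonglongrightarrow> fcalc f x"
proof (rule LIM_zero_cancel, rule Lim_null_comparison)
  show "\<forall>\<^sub>F n in sequentially. norm (pcalc (P n) x - fcalc f x) \<le> e n * norm x"
    using norm_pcalc_minus_fcalc_le[OF assms(1,3)] by simp
  show "(\<lambda>n. e n * norm x) \<longlonglongrightarrow> 0" using tendsto_mult[OF assms(2) tendsto_const] by simp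
qed

lemma fcalc_approximation:
  assumes "continuous_on {-1..1} f"
  obtains P where "\<And>n t. \<bar>t\<bar> \<le> 1 \<Longrightarrow> \<bar>poly (P n) t - f t\<bar> \<le> inverse (real (Suc n))"
    and "\<And>x. (\<lambda>n. pcalc (P n) x) \<longlonglongrightarrow> fcalc f x"
  using Weierstrass_poly_sequence[OF assms] fcalc_tendsto[OF assms LIMSEQ_inverse_real_of_nat]
  by blast

lemma fcalc_cong:
  assumes "\<And>t. \<bar>t\<bar> \<le> 1 \<Longrightarrow> f t = f' t"
  shows "fcalc f = fcalc f'"
proof -
  have "(\<forall>t. \<bar>t\<bar> \<le> 1 \<longrightarrow> \<bar>poly P t - f t\<bar> \<le> e) \<longleftrightarrow> (\<forall>t. \<bar>t\<bar> \<le> 1 \<longrightarrow> \<bar>poly P t - f' t\<bar> \<le> e)"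
    for P e by (auto simp: assms)
  then show ?thesis unfolding fcalc_def by simp
qed

lemma fcalc_poly: "fcalc (poly P) x = pcalc P x"
  using norm_pcalc_minus_fcalc_le[of "poly P" P 0 x] by (simp add: continuous_on_poly)

lemma fcalc_const: "fcalc (\<lambda>_. c) x = c *\<^sub>R x"
proof -
  have "poly [:c:] = (\<lambda>_. c)" by (simp add: fun_eq_iff)
  then show ?thesis
    using fcalc_poly[of "[:c:]" x] by (simp add: opoly_pCons linear_left_mult)
qed

lemma fcalc_id: "fcalc (\<lambda>t. t) x = h * x"
proof -
  have "poly [:0, 1:] = (\<lambda>t::real. t)" by (simp add: fun_eq_iff)
  then show ?thesis
    using fcalc_poly[of "[:0, 1:]" x] by (simp add: opoly_pCons linear_left_mult)
qed

lemma linear_fcalc: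
  assumes "continuous_on {-1..1} f"
  shows "linear (fcalc f)"
proof -
  obtain P where P: "\<And>x. (\<lambda>n. pcalc (P n) x) \<longlonglongrightarrow> fcalc f x"
    using fcalc_approximation[OF assms] by metis
  show ?thesis
  proof (rule linearI)
    fix x y r
    show "fcalc f (x + y) = fcalc f x + fcalc f y"
      using LIMSEQ_unique[OF P[of "x + y"]] tendsto_add[OF P[of x] P[of y]]
      by (simp add: linear_add[OF linear_pcalc])
    show "fcalc f (r *\<^sub>R x) = r *\<^sub>R fcalc f x"
      using LIMSEQ_unique[OF P[of "r *\<^sub>R x"]] tendsto_scaleR[OF tendsto_const P[of x]]
      by (simp add: linear_scale[OF linear_pcalc])
  qed
qed

lemma fcalc_mult_right:
  assumes "continuous_on {-1..1} f"
  shows "fcalc f (x * y) = fcalc f x * y"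
proof -
  obtain P where P: "\<And>x. (\<lambda>n. pcalc (P n) x) \<longlonglongrightarrow> fcalc f x"
    using fcalc_approximation[OF assms] by metis
  have "pcalc Q (x * y) = pcalc Q x * y" for Q
    by (induction Q) (simp_all add: opoly_pCons linear_left_mult distrib_right mult.assoc)
  then show ?thesis
    using LIMSEQ_unique[OF P[of "x * y"]] tendsto_mult[OF P[of x] tendsto_const] by simp
qed

lemma star_fcalc_mult:
  assumes "continuous_on {-1..1} f"
  shows "star (fcalc f x) * y = star x * fcalc f y"
proof -
  obtain P where P: "\<And>x. (\<lambda>n. pcalc (P n) x) \<longlonglongrightarrow> fcalc f x"
    using fcalc_approximation[OF assms] by metis
  have "(\<lambda>n. star (pcalc (P n) x) * y) \<longlonglongrightarrow> star (fcalc f x) * y"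
    by (intro tendsto_intros bounded_linear.tendsto[OF bounded_linear_star] P)
  moreover have "(\<lambda>n. star (pcalc (P n) x) * y) \<longlonglongrightarrow> star x * fcalc f y"
    unfolding star_opoly_mult by (intro tendsto_intros P)
  ultimately show ?thesis by (rule LIMSEQ_unique)
qed

lemma norm_fcalc_le:
  assumes "continuous_on {-1..1} f" and "\<And>t. \<bar>t\<bar> \<le> 1 \<Longrightarrow> \<bar>f t\<bar> \<le> B"
  shows "norm (fcalc f x) \<le> B * norm x"
proof -
  obtain P where P: "\<And>n t. \<bar>t\<bar> \<le> 1 \<Longrightarrow> \<bar>poly (P n) t - f t\<bar> \<le> inverse (real (Suc n))"
    "\<And>x. (\<lambda>n. pcalc (P n) x) \<longlonglongrightarrow> fcalc f x"
    using fcalc_approximation[OF assms(1)] by blast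
  show ?thesis
  proof (rule LIMSEQ_le)
    show "(\<lambda>n. norm (pcalc (P n) x)) \<longlonglongrightarrow> norm (fcalc f x)"
      by (intro tendsto_intros P)
    have "(\<lambda>n. (B + inverse (real (Suc n))) * norm x) \<longlonglongrightarrow> (B + 0) * norm x"
      by (intro tendsto_intros LIMSEQ_inverse_real_of_nat)
    then show "(\<lambda>n. (B + inverse (real (Suc n))) * norm x) \<longlonglongrightarrow> B * norm x" by simp
    have "\<bar>poly (P n) t\<bar> \<le> B + inverse (real (Suc n))" if "\<bar>t\<bar> \<le> 1" for n t
      using P(1)[OF that, of n] assms(2)[OF that] by linarith
    then show "\<exists>N. \<forall>n\<ge>N. norm (pcalc (P n) x) \<le> (B + inverse (real (Suc n))) * norm x"
      using norm_opoly_le by blast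
  qed
qed

text \<open>This covers closed left ideals, and also closed right ideals that contain \<open>h\<close>.\<close>

lemma fcalc_mem:
  assumes "continuous_on {-1..1} f" and "subspace W" and "closed W"
    and "\<And>y. y \<in> W \<Longrightarrow> h * y \<in> W" and "x \<in> W"
  shows "fcalc f x \<in> W"
proof -
  obtain P where P: "\<And>x. (\<lambda>n. pcalc (P n) x) \<longlonglongrightarrow> fcalc f x"
    using fcalc_approximation[OF assms(1)] by metis
  show ?thesis
    by (rule closed_sequentially[OF assms(3) _ P[of x]]) (rule opoly_mem_subspace[OF assms(2,4,5)])
qed

lemma fcalc_add:
  assumes "continuous_on {-1..1} f" and "continuous_on {-1..1} f'"
  shows "fcalc (\<lambda>t. f t + f' t) x = fcalc f x + fcalc f' x"
proof -
  let ?r = "\<lambda>n. inverse (real (Suc n))"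
  obtain P where P: "\<And>n t. \<bar>t\<bar> \<le> 1 \<Longrightarrow> \<bar>poly (P n) t - f t\<bar> \<le> ?r n"
    "\<And>x. (\<lambda>n. pcalc (P n) x) \<longlonglongrightarrow> fcalc f x"
    using fcalc_approximation[OF assms(1)] by blast
  obtain Q where Q: "\<And>n t. \<bar>t\<bar> \<le> 1 \<Longrightarrow> \<bar>poly (Q n) t - f' t\<bar> \<le> ?r n"
    "\<And>x. (\<lambda>n. pcalc (Q n) x) \<longlonglongrightarrow> fcalc f' x"
    using fcalc_approximation[OF assms(2)] by blast
  have "(\<lambda>n. pcalc (P n + Q n) x) \<longlonglongrightarrow> fcalc (\<lambda>t. f t + f' t) x"
  proof (rule fcalc_tendsto)
    show "(\<lambda>n. ?r n + ?r n) \<longlonglongrightarrow> 0"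
      using tendsto_add[OF LIMSEQ_inverse_real_of_nat LIMSEQ_inverse_real_of_nat] by simp
    show "\<bar>poly (P n + Q n) t - (f t + f' t)\<bar> \<le> ?r n + ?r n" if "\<bar>t\<bar> \<le> 1" for n t
      using P(1)[OF that, of n] Q(1)[OF that, of n] by (simp only: poly_add)
  qed (intro continuous_intros assms)
  then show ?thesis
    using LIMSEQ_unique[OF _ tendsto_add[OF P(2)[of x] Q(2)[of x]]] by (simp add: opoly_add)
qed

lemma fcalc_mult:
  assumes "continuous_on {-1..1} f" and "continuous_on {-1..1} f'"
  shows "fcalc (\<lambda>t. f t * f' t) x = fcalc f (fcalc f' x)"
proof -
  let ?r = "\<lambda>n. inverse (real (Suc n))"
  obtain P where P: "\<And>n t. \<bar>t\<bar> \<le> 1 \<Longrightarrow> \<bar>poly (P n) t - f t\<bar> \<le> ?r n"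
    "\<And>x. (\<lambda>n. pcalc (P n) x) \<longlonglongrightarrow> fcalc f x"
    using fcalc_approximation[OF assms(1)] by blast
  obtain Q where Q: "\<And>n t. \<bar>t\<bar> \<le> 1 \<Longrightarrow> \<bar>poly (Q n) t - f' t\<bar> \<le> ?r n"
    "\<And>x. (\<lambda>n. pcalc (Q n) x) \<longlonglongrightarrow> fcalc f' x"
    using fcalc_approximation[OF assms(2)] by blast
  obtain B where B: "B \<ge> 0" "\<And>t. \<bar>t\<bar> \<le> 1 \<Longrightarrow> \<bar>f t\<bar> \<le> B" using continuous_bounded[OF assms(1)] by metis
  obtain B' where B': "B' \<ge> 0" "\<And>t. \<bar>t\<bar> \<le> 1 \<Longrightarrow> \<bar>f' t\<bar> \<le> B'"
    using continuous_bounded[OF assms(2)] by metis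
  have r1: "?r n \<le> 1" for n by (simp add: inverse_le_1_iff)
  have PB: "\<bar>poly (P n) t\<bar> \<le> B + 1" if "\<bar>t\<bar> \<le> 1" for n t
    using P(1)[OF that, of n] B(2)[OF that] r1[of n] by linarith
  have "(\<lambda>n. pcalc (P n * Q n) x) \<longlonglongrightarrow> fcalc (\<lambda>t. f t * f' t) x"
  proof (rule fcalc_tendsto)
    have "(\<lambda>n. (B + 1) * ?r n + B' * ?r n) \<longlonglongrightarrow> (B + 1) * 0 + B' * 0"
      by (intro tendsto_intros LIMSEQ_inverse_real_of_nat)
    then show "(\<lambda>n. (B + 1) * ?r n + B' * ?r n) \<longlonglongrightarrow> 0" by simp
    show "\<bar>poly (P n * Q n) t - f t * f' t\<bar> \<le> (B + 1) * ?r n + B' * ?r n" if t: "\<bar>t\<bar> \<le> 1" for n t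
    proof -
      have "poly (P n * Q n) t - f t * f' t
        = poly (P n) t * (poly (Q n) t - f' t) + f' t * (poly (P n) t - f t)"
        by (simp add: algebra_simps)
      also have "\<bar>\<dots>\<bar> \<le> \<bar>poly (P n) t\<bar> * \<bar>poly (Q n) t - f' t\<bar> + \<bar>f' t\<bar> * \<bar>poly (P n) t - f t\<bar>"
        using abs_triangle_ineq[of "poly (P n) t * (poly (Q n) t - f' t)" "f' t * (poly (P n) t - f t)"]
        by (simp only: abs_mult)
      also have "\<dots> \<le> (B + 1) * ?r n + B' * ?r n"
        using B(1) B'(1) by (intro add_mono mult_mono PB P(1) Q(1) B'(2) t) auto
      finally show ?thesis .
    qed
  qed (intro continuous_intros assms)
  moreover have "(\<lambda>n. pcalc (P n) (pcalc (Q n) x)) \<longlonglongrightarrow> fcalc f (fcalc f' x)"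
  proof -
    have "(\<lambda>n. pcalc (P n) (pcalc (Q n) x - fcalc f' x)) \<longlonglongrightarrow> 0"
    proof (rule Lim_null_comparison)
      show "\<forall>\<^sub>F n in sequentially. norm (pcalc (P n) (pcalc (Q n) x - fcalc f' x))
          \<le> (B + 1) * norm (pcalc (Q n) x - fcalc f' x)"
        by (intro always_eventually allI norm_opoly_le PB)
      have "(\<lambda>n. (B + 1) * norm (pcalc (Q n) x - fcalc f' x)) \<longlonglongrightarrow> (B + 1) * norm (fcalc f' x - fcalc f' x)"
        by (intro tendsto_intros Q)
      then show "(\<lambda>n. (B + 1) * norm (pcalc (Q n) x - fcalc f' x)) \<longlonglongrightarrow> 0" by simp
    qed
    from tendsto_add[OF this P(2)[of "fcalc f' x"]] show ?thesis
      by (simp add: linear_diff[OF linear_pcalc])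
  qed
  ultimately show ?thesis
    by (simp add: opoly_mult[OF linear_left_mult] LIMSEQ_unique)
qed

lemma fcalc_h_mult:
  assumes "continuous_on {-1..1} f"
  shows "fcalc f h * y = fcalc (\<lambda>t. f t * t) y"
  using assms by (simp add: fcalc_mult fcalc_id fcalc_mult_right continuous_intros)

lemma star_fcalc_h:
  assumes "continuous_on {-1..1} f"
  shows "star (fcalc f h) = fcalc f h"
proof (rule eq_if_left_mult_eq)
  fix y
  have "star (fcalc f h) * y = fcalc (\<lambda>t. t * f t) y"
    using assms by (simp add: star_fcalc_mult selfadjoint fcalc_mult fcalc_id continuous_intros)
  then show "star (fcalc f h) * y = fcalc f h * y"
    using assms by (simp add: fcalc_h_mult mult.commute)
qed

lemma norm_fcalc_h_le:
  assumes "continuous_on {-1..1} f" and "\<And>t. \<bar>t\<bar> \<le> 1 \<Longrightarrow> \<bar>f t * t\<bar> \<le> B"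
  shows "norm (fcalc f h) \<le> B"
proof (rule norm_le_if_left_mult_le)
  show "norm (fcalc f h * y) \<le> B * norm y" for y
    unfolding fcalc_h_mult[OF assms(1)]
    by (rule norm_fcalc_le) (intro continuous_intros assms | fact)+
  show "B \<ge> 0" using assms(2)[of 0] by simp
qed

lemma fcalc_h_mult_fcalc_h:
  assumes "continuous_on {-1..1} f" and "continuous_on {-1..1} f'"
  shows "fcalc f h * fcalc f' h = fcalc (\<lambda>t. f t * (t * f' t)) h"
  using assms by (simp add: fcalc_h_mult fcalc_mult fcalc_id continuous_intros)

lemma fcalc_h_diff:
  assumes "continuous_on {-1..1} f" and "continuous_on {-1..1} f'"
  shows "fcalc (\<lambda>t. f t - f' t) h = fcalc f h - fcalc f' h"
  using fcalc_add[of "\<lambda>t. f t - f' t" f' h] assms by (simp add: continuous_intros)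

lemma norm_fcalc_h_diff_le:
  assumes "continuous_on {-1..1} f" and "continuous_on {-1..1} f'"
    and "\<And>t. \<bar>t\<bar> \<le> 1 \<Longrightarrow> \<bar>f t - f' t\<bar> \<le> e"
  shows "norm (fcalc f h - fcalc f' h) \<le> e"
proof -
  have "norm (fcalc (\<lambda>t. f t - f' t) h) \<le> e"
  proof (rule norm_fcalc_h_le)
    fix t :: real assume t: "\<bar>t\<bar> \<le> 1"
    have "\<bar>(f t - f' t) * t\<bar> \<le> e * 1"
      unfolding abs_mult by (intro mult_mono assms(3) t) (use assms(3)[OF t] in auto)
    then show "\<bar>(f t - f' t) * t\<bar> \<le> e" by simp
  qed (intro continuous_intros assms)
  then show ?thesis by (simp add: fcalc_h_diff assms)
qed

end

section \<open>Approximate units and factorization in closed ideals\<close>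

lemma geometric_increments_converge:
  fixes x :: "nat \<Rightarrow> 'v::banach"
  assumes "\<And>n. norm (x (Suc n) - x n) \<le> C * (1/2) ^ n"
  obtains l where "x \<longlonglongrightarrow> l" and "norm (l - x 0) \<le> 2 * C"
proof -
  have sums: "(\<lambda>n. C * (1/2) ^ n) sums (2 * C)"
    using sums_mult[OF geometric_sums[of "1/2::real"], of C] by (simp add: mult.commute)
  have summable: "summable (\<lambda>n. norm (x (Suc n) - x n))"
    by (rule summable_comparison_test'[OF sums_summable[OF sums]]) (use assms in simp)
  define s where "s = (\<Sum>n. x (Suc n) - x n)"
  have "(\<lambda>n. x (Suc n) - x n) sums s"
    unfolding s_def by (rule summable_sums[OF summable_norm_cancel[OF summable]])
  then have "(\<lambda>n. x n - x 0) \<longlonglongrightarrow> s"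
    by (simp add: sums_def sum_lessThan_telescope)
  then have "(\<lambda>n. (x n - x 0) + x 0) \<longlonglongrightarrow> s + x 0" by (intro tendsto_intros)
  moreover have "norm s \<le> 2 * C"
  proof -
    have "norm s \<le> (\<Sum>n. norm (x (Suc n) - x n))"
      unfolding s_def by (rule summable_norm[OF summable])
    also have "\<dots> \<le> (\<Sum>n. C * (1/2) ^ n)"
      by (rule suminf_le[OF assms summable sums_summable[OF sums]])
    finally show ?thesis using sums_unique[OF sums] by simp
  qed
  ultimately show ?thesis by (intro that[of "s + x 0"]) auto
qed

text \<open>The operator \<open>G\<close> is the inverse of left multiplication by \<open>(1 + e) / 2\<close>, an element of the
unitization.  The factorization below multiplies such elements and needs inverses with
a uniform bound.\<close>

definition local_unit :: "'a::cstar_algebra \<Rightarrow> bool" where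
  "local_unit e \<longleftrightarrow> star e = e \<and> norm e \<le> 1 \<and>
    (\<exists>G. linear G \<and> (\<forall>x. norm (G x) \<le> 2 * norm x) \<and>
      (\<forall>x. G x + e * G x = 2 *\<^sub>R x) \<and> (\<forall>x. G (x + e * x) = 2 *\<^sub>R x))"

lemma local_unit_0: "local_unit 0"
  unfolding local_unit_def
  by (intro conjI exI[of _ "\<lambda>x. 2 *\<^sub>R x"]) (auto simp: star_zero intro: linear_scale_self)

locale closed_ideal =
  fixes J :: "'a::cstar_algebra set"
  assumes subspace: "subspace J" and closed: "closed J"
    and mult_left: "\<And>a x. x \<in> J \<Longrightarrow> a * x \<in> J"
    and mult_right: "\<And>a x. x \<in> J \<Longrightarrow> x * a \<in> J"
begin

lemmas add = subspace_add[OF subspace] and diff = subspace_diff[OF subspace]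
  and scale = subspace_scale[OF subspace] and zero = subspace_0[OF subspace]

text \<open>With \<open>h = c * star c\<close>, take \<open>e = f(h)\<close> for \<open>f t = t\<^sup>2 / (\<delta>\<^sup>2 + t\<^sup>2)\<close>.  The C*-identity turns the error
\<open>c - e * c\<close> into \<open>(1 - f(h)) h (1 - f(h))\<close>, which is small because \<open>(1 - f t)\<^sup>2 * \<bar>t\<bar> \<le> \<delta>\<close>.
Only \<open>c * star c \<in> J\<close> is assumed so that \<open>c \<in> J\<close> can be concluded later.\<close>

lemma local_unit_single:
  assumes c: "c * star c \<in> J" and "\<epsilon> > 0"
  obtains e where "e \<in> J" "local_unit e" "norm (c - e * c) \<le> \<epsilon>"
proof -
  define r where "r = inverse (2 * (1 + norm c))"
  have pos: "1 + norm c > 0" by (simp add: add_pos_nonneg)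
  then have r: "r > 0" by (simp add: r_def)
  define h where "h = (r *\<^sub>R c) * star (r *\<^sub>R c)"
  have "norm (r *\<^sub>R c) \<le> 1/2"
    using pos by (simp add: r_def field_simps)
  then have "(norm (r *\<^sub>R c))\<^sup>2 \<le> (1/2)\<^sup>2" by (intro power_mono) auto
  then have nh: "norm h \<le> 1/2"
    unfolding h_def cstar_identity' by (simp add: power2_eq_square)
  interpret small_selfadjoint h
  proof
    show "star h = h" by (simp only: h_def star_mult star_star)
    show "norm h \<le> 1/2" by (rule nh)
  qed
  have hJ: "h \<in> J" using c by (simp add: h_def star_scaleR scale)
  \<comment> \<open>The error estimate below bounds the square of the norm of \<open>r *\<^sub>R (c - e * c)\<close> by \<open>\<delta>\<close>.\<close>
  define \<delta> where "\<delta> = (r * \<epsilon>)\<^sup>2"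
  have \<delta>: "\<delta> > 0" using r \<open>\<epsilon> > 0\<close> by (simp add: \<delta>_def)
  define p where "p t = \<delta>\<^sup>2 + t\<^sup>2" for t :: real
  have p: "p t > 0" for t using \<delta> by (simp add: p_def add_pos_nonneg)
  then have p0: "p t \<noteq> 0" for t by (metis less_irrefl)
  have cp: "continuous_on S p" for S unfolding p_def by (intro continuous_intros)
  define q where "q t = t / p t" for t
  define k where "k t = \<delta>\<^sup>2 / p t" for t
  define u where "u t = 2 / (1 + q t * t)" for t
  have qk: "q t * t = 1 - k t" for t
    using p0[of t] by (simp add: q_def k_def field_simps power2_eq_square p_def)
  have k: "0 \<le> k t" "k t \<le> 1" for t
    using p[of t] by (simp_all add: k_def p_def)
  have cq: "continuous_on {-1..1} q" unfolding q_def by (intro continuous_intros cp) (use p0 in auto)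
  have ck: "continuous_on {-1..1} k" unfolding k_def by (intro continuous_intros cp) (use p0 in auto)
  have den: "1 + q t * t \<noteq> 0" for t using k[of t] by (simp add: qk)
  have cu: "continuous_on {-1..1} u"
    unfolding u_def by (intro continuous_intros cq) (use den in auto)
  have ku: "\<bar>k t * t\<bar> \<le> \<delta>" for t
  proof -
    have "2 * (\<delta> * \<bar>t\<bar>) \<le> p t" using zero_le_power2[of "\<delta> - \<bar>t\<bar>"] by (simp add: p_def power2_diff)
    moreover have "0 \<le> \<delta> * \<bar>t\<bar>" using \<delta> by simp
    ultimately have "\<delta> * (\<delta> * \<bar>t\<bar>) \<le> \<delta> * p t" using \<delta> by (intro mult_left_mono) linarith+
    then show ?thesis using p[of t] \<delta> by (simp add: k_def abs_mult power2_eq_square field_simps)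
  qed
  define e where "e = fcalc q h"
  have e_mult: "e * y = fcalc (\<lambda>t. q t * t) y" for y
    unfolding e_def by (rule fcalc_h_mult[OF cq])
  have eJ: "e \<in> J" unfolding e_def by (rule fcalc_mem[OF cq subspace closed mult_left hJ])
  have one_plus: "fcalc (\<lambda>t. 1 + q t * t) x = x + e * x" for x
    using fcalc_add[of "\<lambda>t. 1" "\<lambda>t. q t * t" x] fcalc_const[of 1 x]
    by (simp add: e_mult cq continuous_intros)
  have "local_unit e"
    unfolding local_unit_def
  proof (intro conjI exI[of _ "fcalc u"] allI)
    show "star e = e" unfolding e_def by (rule star_fcalc_h[OF cq])
    show "norm e \<le> 1" unfolding e_def
      by (rule norm_fcalc_h_le[OF cq]) (use k in \<open>simp add: qk abs_le_iff\<close>)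
    show "linear (fcalc u)" by (rule linear_fcalc[OF cu])
    show "norm (fcalc u x) \<le> 2 * norm x" for x
    proof (rule norm_fcalc_le[OF cu])
      have "\<bar>2 / x\<bar> \<le> 2" if "x \<ge> 1" for x :: real using that by (simp add: divide_le_eq)
      then show "\<bar>u t\<bar> \<le> 2" for t using k[of t] by (simp add: u_def qk)
    qed
    have c1: "continuous_on {-1..1} (\<lambda>t. 1 + q t * t)" by (intro continuous_intros cq)
    have 1: "fcalc (\<lambda>t. (1 + q t * t) * u t) x = 2 *\<^sub>R x" for x
    proof -
      have "x * (2 / x) = 2" if "x \<noteq> 0" for x :: real using that by simp
      then have "(1 + q t * t) * u t = 2" for t using den[of t] by (simp only: u_def)
      then show ?thesis using fcalc_const[of 2 x] by simp
    qed
    then show "fcalc u x + e * fcalc u x = 2 *\<^sub>R x" for x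
      by (simp add: fcalc_mult[OF c1 cu] one_plus)
    show "fcalc u (x + e * x) = 2 *\<^sub>R x" for x
    proof -
      have "fcalc u (x + e * x) = fcalc (\<lambda>t. u t * (1 + q t * t)) x"
        by (simp only: one_plus fcalc_mult[OF cu c1])
      then show ?thesis using 1[of x] by (simp only: mult.commute[of "u _"])
    qed
  qed
  moreover have "norm (c - e * c) \<le> \<epsilon>"
  proof -
    have k_eq: "fcalc k x = x - e * x" for x
    proof -
      have "fcalc (\<lambda>t. k t + q t * t) x = fcalc k x + e * x"
        using cq ck by (simp add: fcalc_add e_mult continuous_intros)
      then have "x = fcalc k x + e * x" using fcalc_const[of 1 x] by (simp add: qk)
      then show ?thesis by (simp add: eq_diff_eq)
    qed
    define z where "z = fcalc k (r *\<^sub>R c)"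
    have "z * star z = fcalc k (r *\<^sub>R c * star z)" by (simp only: z_def fcalc_mult_right[OF ck])
    also have "r *\<^sub>R c * star z = star (z * star (r *\<^sub>R c))" by (simp only: star_mult star_star)
    also have "z * star (r *\<^sub>R c) = fcalc k h" by (simp only: z_def fcalc_mult_right[OF ck, symmetric] h_def[symmetric])
    also have "star (fcalc k h) = fcalc k h" by (rule star_fcalc_h[OF ck])
    also have "fcalc k (fcalc k h) = fcalc (\<lambda>t. k t * k t) h" by (rule fcalc_mult[OF ck ck, symmetric])
    finally have "norm (z * star z) = norm (fcalc (\<lambda>t. k t * k t) h)" by simp
    also have "\<dots> \<le> \<delta>"
    proof (rule norm_fcalc_h_le)
      fix t
      have "\<bar>k t * k t * t\<bar> = k t * \<bar>k t * t\<bar>" using k[of t] by (simp add: abs_mult mult.assoc)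
      also have "\<dots> \<le> 1 * \<delta>" using k[of t] ku[of t] by (intro mult_mono) auto
      finally show "\<bar>k t * k t * t\<bar> \<le> \<delta>" by simp
    qed (intro continuous_intros ck)
    finally have "(norm z)\<^sup>2 \<le> (r * \<epsilon>)\<^sup>2" unfolding cstar_identity' \<delta>_def .
    then have "norm z \<le> r * \<epsilon>" by (rule power2_le_imp_le) (use r \<open>\<epsilon> > 0\<close> in simp)
    moreover have "z = r *\<^sub>R (c - e * c)" by (simp add: z_def k_eq scaleR_diff_right)
    ultimately show ?thesis using r by simp
  qed
  ultimately show ?thesis using that eJ by blast
qed

text \<open>Here \<open>star x\<close> is the limit of the elements \<open>star x * e\<close>, where \<open>e \<in> J\<close> is an approximate left unit
for \<open>x\<close>.\<close>

lemma star_mem: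
  assumes "x \<in> J"
  shows "star x \<in> J"
proof -
  have "\<exists>y\<in>J. dist y (star x) < \<epsilon>" if "\<epsilon> > 0" for \<epsilon>
  proof -
    obtain e where e: "e \<in> J" "local_unit e" "norm (x - e * x) \<le> \<epsilon> / 2"
      using local_unit_single[of x "\<epsilon> / 2"] assms mult_right \<open>\<epsilon> > 0\<close> by auto
    have "star (x - e * x) = star x - star x * e"
      using e(2) by (simp add: star_diff star_mult local_unit_def)
    then have "norm (star x - star x * e) < \<epsilon>"
      using e(3) norm_star[of "x - e * x"] \<open>\<epsilon> > 0\<close> by simp
    then show ?thesis using mult_left[OF e(1)] by (metis dist_commute dist_norm)
  qed
  then show ?thesis using closed by (meson closed_approachable)
qed

text \<open>This says that the involution of the quotient by \<open>J\<close> is proper.\<close>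

lemma mem_if_mult_star_mem:
  assumes "x * star x \<in> J"
  shows "x \<in> J"
proof -
  have "\<exists>y\<in>J. dist y x < \<epsilon>" if "\<epsilon> > 0" for \<epsilon>
  proof -
    obtain e where e: "e \<in> J" "norm (x - e * x) \<le> \<epsilon> / 2"
      using local_unit_single[OF assms, of "\<epsilon> / 2"] \<open>\<epsilon> > 0\<close> by auto
    then have "norm (x - e * x) < \<epsilon>" using \<open>\<epsilon> > 0\<close> by simp
    then show ?thesis using mult_right[OF e(1)] by (metis dist_commute dist_norm)
  qed
  then show ?thesis using closed by (meson closed_approachable)
qed

text \<open>Composing \<open>1 - e1\<close> with \<open>1 - e2\<close> takes care of one more element but would let the norm of the unit
grow.  A third local unit \<open>e3\<close>, chosen for the single element \<open>e' = e1 + e2 - e2 * e1\<close>, replaces \<open>e'\<close>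
and restores the bound.\<close>

lemma local_unit_finite:
  assumes "finite F" and "F \<subseteq> J" and "\<epsilon> > 0"
  shows "\<exists>e\<in>J. local_unit e \<and> (\<forall>x\<in>F. norm (x - e * x) \<le> \<epsilon>)"
  using assms
proof (induction F arbitrary: \<epsilon> rule: finite_induct)
  case empty
  then show ?case using local_unit_0 zero by auto
next
  case (insert x F)
  obtain e1 where e1: "e1 \<in> J" "local_unit e1" "\<forall>y\<in>F. norm (y - e1 * y) \<le> \<epsilon> / 8"
    using insert.IH[of "\<epsilon> / 8"] insert.prems by auto
  have "x - e1 * x \<in> J" using insert.prems by (auto intro: diff mult_left)
  then obtain e2 where e2: "e2 \<in> J" "local_unit e2"
    "norm ((x - e1 * x) - e2 * (x - e1 * x)) \<le> \<epsilon> / 8"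
    using local_unit_single[of "x - e1 * x" "\<epsilon> / 8"] mult_right insert.prems by auto
  define e' where "e' = e1 + e2 - e2 * e1"
  have e'J: "e' \<in> J" unfolding e'_def by (intro add diff mult_left e1 e2)
  define N where "N = 1 + (\<Sum>y\<in>insert x F. norm y)"
  have N: "norm y \<le> N" if "y \<in> insert x F" for y
    unfolding N_def using member_le_sum[OF that, of norm] insert.hyps by simp
  have "N \<ge> 1" unfolding N_def by (simp add: sum_nonneg)
  obtain e3 where e3: "e3 \<in> J" "local_unit e3" "norm (e' - e3 * e') \<le> \<epsilon> / (2 * N)"
    using local_unit_single[of e' "\<epsilon> / (2 * N)"] mult_right[OF e'J] insert.prems \<open>N \<ge> 1\<close> by auto
  have unit: "norm (v - e * v) \<le> 2 * norm v" if "local_unit e" for e v :: 'a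
  proof -
    have "norm (e * v) \<le> 1 * norm v"
      using that norm_mult_ineq[of e v] mult_right_mono[of "norm e" 1 "norm v"]
      by (simp add: local_unit_def)
    then show ?thesis using norm_triangle_ineq4[of v "e * v"] by simp
  qed
  have "norm (y - e3 * y) \<le> \<epsilon>" if y: "y \<in> insert x F" for y
  proof -
    have e': "y - e' * y = (y - e1 * y) - e2 * (y - e1 * y)"
      by (simp add: e'_def algebra_simps)
    have "norm (y - e' * y) \<le> \<epsilon> / 4"
    proof (cases "y = x")
      case True
      then show ?thesis unfolding e' using e2(3) insert.prems by simp
    next
      case False
      then have "norm (y - e1 * y) \<le> \<epsilon> / 8" using y e1(3) by simp
      then show ?thesis unfolding e' using unit[OF e2(2), of "y - e1 * y"] by linarith
    qed
    then have "norm ((y - e' * y) - e3 * (y - e' * y)) \<le> \<epsilon> / 2"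
      using unit[OF e3(2), of "y - e' * y"] by linarith
    moreover have "norm ((e' - e3 * e') * y) \<le> \<epsilon> / 2"
    proof -
      have "norm ((e' - e3 * e') * y) \<le> norm (e' - e3 * e') * norm y" by (rule norm_mult_ineq)
      also have "\<dots> \<le> \<epsilon> / (2 * N) * N"
        using N[OF y] e3(3) \<open>N \<ge> 1\<close> insert.prems by (intro mult_mono) auto
      finally show ?thesis using \<open>N \<ge> 1\<close> by simp
    qed
    moreover have eq: "y - e3 * y = (e' - e3 * e') * y + ((y - e' * y) - e3 * (y - e' * y))"
      by (simp add: algebra_simps)
    ultimately show ?thesis
      unfolding eq
      using norm_triangle_ineq[of "(e' - e3 * e') * y" "(y - e' * y) - e3 * (y - e' * y)"]
      by linarith
  qed
  then show ?case using e3 by blast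
qed

lemma local_unit_null_sequence:
  assumes "finite F" "F \<subseteq> J" "\<epsilon> > 0" and z: "\<And>m. z m \<in> J" "z \<longlonglongrightarrow> 0"
  obtains e where "e \<in> J" "local_unit e" "\<And>x. x \<in> F \<Longrightarrow> norm (x - e * x) \<le> \<epsilon>"
    "\<And>m. norm (z m - e * z m) \<le> \<epsilon>"
proof -
  obtain M where M: "\<And>m. m \<ge> M \<Longrightarrow> norm (z m) < \<epsilon> / 2"
    using LIMSEQ_D[OF z(2), of "\<epsilon> / 2"] \<open>\<epsilon> > 0\<close> by auto
  obtain e where e: "e \<in> J" "local_unit e" "\<forall>x\<in>F \<union> z ` {..<M}. norm (x - e * x) \<le> \<epsilon>"
    using local_unit_finite[of "F \<union> z ` {..<M}" \<epsilon>] assms by blast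
  have "norm (z m - e * z m) \<le> \<epsilon>" for m
  proof (cases "m < M")
    case False
    have "norm (e * z m) \<le> 1 * norm (z m)"
      using e(2) norm_mult_ineq[of e "z m"] mult_right_mono[of "norm e" 1 "norm (z m)"]
      by (simp add: local_unit_def)
    then show ?thesis using norm_triangle_ineq4[of "z m" "e * z m"] M[of m] False by simp
  qed (use e in auto)
  then show ?thesis using that e by blast
qed

text \<open>Cohen's factorization.  Choose local units \<open>e 0, e 1, \<dots>\<close> and put \<open>F k = (1 + e k) / 2\<close> in the
unitization.  The product \<open>F 0 \<cdots> F (n - 1)\<close> is \<open>(1/2) ^ n + j n\<close> with \<open>j n \<in> J\<close>, and the sequence
\<open>w n\<close> arises from \<open>z\<close> by applying the inverse of this product.  If \<open>e n\<close> is almost a right unit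
for \<open>j n\<close> and almost a left unit for all terms of \<open>w n\<close>, both sequences converge, and the scalar
part of the product tends to zero.\<close>

lemma null_sequence_factorization:
  assumes z: "\<And>m. z m \<in> J" "z \<longlonglongrightarrow> 0"
  obtains y w B where "y \<in> J" "\<And>m. z m = y * w m" "\<And>m. norm (w m) \<le> (B::real)"
proof -
  \<comment> \<open>A state is the pair of \<open>j n\<close> and \<open>w n\<close>; \<open>Next\<close> also records that the initial sequence is \<open>z\<close>.\<close>
  define Inv where "Inv n s \<longleftrightarrow> (case s of (j, w) \<Rightarrow> j \<in> J \<and> (\<forall>m. w m \<in> J) \<and> w \<longlonglongrightarrow> 0 \<and>
    (\<forall>m. z m = (1/2) ^ n *\<^sub>R w m + j * w m))" for n and s :: "'a \<times> (nat \<Rightarrow> 'a)"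
  define Next where "Next n s s' \<longleftrightarrow> (n = 0 \<longrightarrow> snd s = z) \<and> norm (fst s' - fst s) \<le> 2 * (1/2) ^ n \<and>
    (\<forall>m. norm (snd s' m - snd s m) \<le> 1 * (1/2) ^ n)" for n and s s' :: "'a \<times> (nat \<Rightarrow> 'a)"
  have "\<exists>s'. (Inv (Suc n) s' \<and> (Suc n = 0 \<longrightarrow> snd s' = z)) \<and> Next n s s'"
    if s: "Inv n s \<and> (n = 0 \<longrightarrow> snd s = z)" for n s
  proof -
    obtain j w where jw: "s = (j, w)" by (cases s)
    have j: "j \<in> J" and w: "\<And>m. w m \<in> J" "w \<longlonglongrightarrow> 0"
      and zw: "\<And>m. z m = (1/2) ^ n *\<^sub>R w m + j * w m"
      using s by (auto simp: Inv_def jw)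
    obtain e where e: "e \<in> J" "local_unit e" "\<And>x. x \<in> {star j} \<Longrightarrow> norm (x - e * x) \<le> (1/2) ^ n"
      "\<And>m. norm (w m - e * w m) \<le> (1/2) ^ n"
      using local_unit_null_sequence[of "{star j}" "(1/2) ^ n", OF _ _ _ w] star_mem[OF j] by auto
    obtain G where G: "linear G" "\<And>x. norm (G x) \<le> 2 * norm x" "\<And>x. G x + e * G x = 2 *\<^sub>R x"
      "\<And>x. G (x + e * x) = 2 *\<^sub>R x" and se: "star e = e" and ne: "norm e \<le> 1"
      using e(2) by (auto simp: local_unit_def)
    define j' where "j' = (1/2) ^ Suc n *\<^sub>R e + (1/2) *\<^sub>R (j + j * e)"
    have GJ: "G x \<in> J" if "x \<in> J" for x
    proof -
      have "G x = 2 *\<^sub>R x - e * G x" using G(3)[of x] by (simp add: algebra_simps)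
      then show ?thesis by (metis diff scale that mult_right e(1))
    qed
    have "j' \<in> J" unfolding j'_def by (intro add scale mult_left e j)
    moreover have "(\<lambda>m. G (w m)) \<longlonglongrightarrow> 0"
    proof (rule Lim_null_comparison)
      show "(\<lambda>m. 2 * norm (w m)) \<longlonglongrightarrow> 0"
        using tendsto_mult[OF tendsto_const tendsto_norm[OF w(2)], of 2] by simp
    qed (simp add: G(2))
    moreover have "z m = (1/2) ^ Suc n *\<^sub>R G (w m) + j' * G (w m)" for m
    proof -
      have "w m = (1/2) *\<^sub>R (G (w m) + e * G (w m))" by (simp add: G(3))
      then have "z m = (1/2) ^ n *\<^sub>R ((1/2) *\<^sub>R (G (w m) + e * G (w m)))
          + j * ((1/2) *\<^sub>R (G (w m) + e * G (w m)))"
        using zw[of m] by metis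
      then show ?thesis by (simp add: j'_def algebra_simps)
    qed
    ultimately have "Inv (Suc n) (j', \<lambda>m. G (w m))" using w GJ by (simp add: Inv_def)
    moreover have "norm (j' - j) \<le> 2 * (1/2) ^ n"
    proof -
      have "norm (j * e - j) = norm (star j - e * star j)"
        using norm_star[of "j * e - j"] by (simp add: star_diff star_mult se norm_minus_commute)
      then have "norm (j * e - j) \<le> (1/2) ^ n" using e(3)[of "star j"] by simp
      then have "norm ((1/2) *\<^sub>R (j * e - j)) \<le> (1/2) ^ n"
        using norm_ge_zero[of "j * e - j"] by (simp only: norm_scaleR)
      moreover have "norm ((1/2) ^ Suc n *\<^sub>R e) \<le> (1/2) ^ n"
        using ne mult_left_le[of "norm e" "(1/2::real) ^ n"] by simp
      moreover have eq: "j' - j = (1/2) ^ Suc n *\<^sub>R e + (1/2) *\<^sub>R (j * e - j)"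
        by (simp add: j'_def algebra_simps flip: scaleR_add_left)
      ultimately show ?thesis
        unfolding eq
        using norm_triangle_ineq[of "(1/2) ^ Suc n *\<^sub>R e" "(1/2) *\<^sub>R (j * e - j)"] by linarith
    qed
    moreover have "norm (G (w m) - w m) \<le> 1 * (1/2) ^ n" for m
    proof -
      have eq: "w m - e * w m = 2 *\<^sub>R w m - (w m + e * w m)" by (simp add: scaleR_2)
      have "G (w m - e * w m) = 2 *\<^sub>R (G (w m) - w m)"
        unfolding eq linear_diff[OF G(1)] G(4) linear_scale[OF G(1)] by (simp add: scaleR_diff_right)
      then have "2 * norm (G (w m) - w m) = norm (G (w m - e * w m))" by simp
      then show ?thesis using G(2)[of "w m - e * w m"] e(4)[of m] by simp
    qed
    ultimately show ?thesis
      using s by (intro exI[of _ "(j', \<lambda>m. G (w m))"]) (simp add: Next_def jw)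
  qed
  moreover have "Inv 0 (0, z) \<and> (0 = (0::nat) \<longrightarrow> snd (0::'a, z) = z)" using z zero by (simp add: Inv_def)
  ultimately obtain s where s: "\<And>n. Inv n (s n)" "\<And>n. Next n (s n) (s (Suc n))"
    using dependent_nat_choice[of "\<lambda>n s. Inv n s \<and> (n = 0 \<longrightarrow> snd s = z)" Next] by metis
  define j where "j n = fst (s n)" for n
  define w where "w n = snd (s n)" for n
  have inv: "j n \<in> J" "z m = (1/2) ^ n *\<^sub>R w n m + j n * w n m" for n m
    using s(1)[of n] by (auto simp: Inv_def j_def w_def split: prod.splits)
  have "w 0 = z" using s(2)[of 0] by (simp add: Next_def w_def)
  have "norm (j (Suc n) - j n) \<le> 2 * (1/2) ^ n" for n
    using s(2)[of n] by (simp add: Next_def j_def)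
  then obtain y where y: "j \<longlonglongrightarrow> y" by (rule geometric_increments_converge)
  have "norm (w (Suc n) m - w n m) \<le> 1 * (1/2) ^ n" for n m
    using s(2)[of n] by (simp add: Next_def w_def)
  then have "\<exists>l. (\<lambda>n. w n m) \<longlonglongrightarrow> l \<and> norm (l - w 0 m) \<le> 2 * 1" for m
    by (rule geometric_increments_converge[of "\<lambda>n. w n m"]) blast
  then obtain l where l: "\<And>m. (\<lambda>n. w n m) \<longlonglongrightarrow> l m" "\<And>m. norm (l m - z m) \<le> 2"
    using \<open>w 0 = z\<close> by (metis mult_1_right)
  obtain B where B: "\<And>m. norm (z m) \<le> B"
    using Bseq_def convergent_imp_Bseq[OF convergentI[OF z(2)]] by blast
  show ?thesis
  proof (rule that[of y l "B + 2"])
    show "y \<in> J" by (rule closed_sequentially[OF closed inv(1) y])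
    show "z m = y * l m" for m
    proof (rule LIMSEQ_unique)
      show "(\<lambda>n. (1/2) ^ n *\<^sub>R w n m + j n * w n m) \<longlonglongrightarrow> z m" by (simp flip: inv(2))
      have "(\<lambda>n. (1/2) ^ n *\<^sub>R w n m + j n * w n m) \<longlonglongrightarrow> 0 *\<^sub>R l m + y * l m"
        by (intro tendsto_intros l y) simp
      then show "(\<lambda>n. (1/2) ^ n *\<^sub>R w n m + j n * w n m) \<longlonglongrightarrow> y * l m" by simp
    qed
    show "norm (l m) \<le> B + 2" for m
      using B[of m] l(2)[of m] norm_triangle_ineq[of "l m - z m" "z m"] by simp
  qed
qed

text \<open>Elements of \<open>J\<close> on which \<open>D\<close> is large form, after scaling, a null sequence with unbounded images; but
\<open>D\<close> is bounded along a sequence that has a common left factor in \<open>J\<close> and bounded right factors.\<close>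

lemma bounded_if_left_multiples_bounded:
  fixes D :: "'a \<Rightarrow> 'x::real_normed_vector"
  assumes "linear D" and "\<And>a. a \<in> J \<Longrightarrow> \<exists>K. \<forall>c. norm (D (a * c)) \<le> K * norm c"
  shows "\<exists>K. \<forall>x\<in>J. norm (D x) \<le> K * norm x"
proof (rule ccontr)
  assume contr: "\<not> ?thesis"
  have "\<exists>x. x \<in> J \<and> norm x = inverse (real (Suc m)) \<and> norm (D x) > real (Suc m)" for m
  proof -
    obtain x where x: "x \<in> J" "norm (D x) > (real (Suc m) * real (Suc m)) * norm x"
      using contr by (meson not_le)
    then have "norm x > 0" using linear_0[OF assms(1)] by auto
    define r where "r = inverse (real (Suc m) * norm x)"
    have "r > 0" using \<open>norm x > 0\<close> by (simp add: r_def)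
    have "norm (D (r *\<^sub>R x)) = r * norm (D x)"
      using \<open>r > 0\<close> by (simp add: linear_scale[OF assms(1)])
    also have "\<dots> > r * ((real (Suc m) * real (Suc m)) * norm x)"
      using x(2) \<open>r > 0\<close> by (rule mult_strict_left_mono)
    also have "r * ((real (Suc m) * real (Suc m)) * norm x) = real (Suc m)"
      using \<open>norm x > 0\<close> by (simp add: r_def field_simps del: of_nat_Suc)
    finally have "norm (D (r *\<^sub>R x)) > real (Suc m)" .
    moreover have "norm (r *\<^sub>R x) = inverse (real (Suc m))"
      using \<open>norm x > 0\<close> \<open>r > 0\<close> by (simp add: r_def)
    ultimately show ?thesis using scale[OF x(1)] by blast
  qed
  then obtain z where z: "\<And>m. z m \<in> J" "\<And>m. norm (z m) = inverse (real (Suc m))"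
    "\<And>m. norm (D (z m)) > real (Suc m)" by metis
  have "(\<lambda>m. norm (z m)) \<longlonglongrightarrow> 0" unfolding z(2) by (rule LIMSEQ_inverse_real_of_nat)
  then have "z \<longlonglongrightarrow> 0" by (rule tendsto_norm_zero_cancel)
  then obtain y w B where f: "y \<in> J" "\<And>m. z m = y * w m" "\<And>m. norm (w m) \<le> B"
    using null_sequence_factorization[of z, OF z(1)] by blast
  obtain K where K: "\<And>c. norm (D (y * c)) \<le> K * norm c" using assms(2)[OF f(1)] by blast
  have "real (Suc m) < \<bar>K\<bar> * B" for m
  proof -
    have "norm (D (z m)) \<le> \<bar>K\<bar> * norm (w m)"
      using K[of "w m"] f(2)[of m] mult_right_mono[OF abs_ge_self, of "norm (w m)" K] by simp
    also have "\<dots> \<le> \<bar>K\<bar> * B" by (intro mult_left_mono f) simp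
    finally show ?thesis using z(3)[of m] by simp
  qed
  moreover obtain m where "\<bar>K\<bar> * B < real m" using reals_Archimedean2 by blast
  ultimately show False by (metis less_trans less_irrefl of_nat_less_iff lessI)
qed

end

section \<open>The continuity ideal\<close>

text \<open>The Banach--Steinhaus theorem: by Baire's theorem the sequence is bounded uniformly on some ball.\<close>

lemma bounded_pointwise_limit:
  fixes f :: "nat \<Rightarrow> 'v::banach \<Rightarrow> 'x::real_normed_vector"
  assumes f: "\<And>n. bounded_linear (f n)" and lim: "\<And>x. (\<lambda>n. f n x) \<longlonglongrightarrow> g x"
  shows "\<exists>K. \<forall>x. norm (g x) \<le> K * norm x"
proof -
  define C where "C m = {x. \<forall>n. norm (f n x) \<le> real m}" for m :: nat
  have closed_C: "closed (C m)" for m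
    unfolding C_def
    by (intro closed_Collect_all closed_Collect_le continuous_on_norm linear_continuous_on f
        continuous_on_const)
  have "\<exists>m. x \<in> C m" for x
  proof -
    obtain B where B: "\<And>n. norm (f n x) \<le> B"
      using convergent_imp_Bseq[OF convergentI[OF lim[of x]]] unfolding Bseq_def by blast
    obtain m where "B \<le> real m" using real_arch_simple by blast
    then show ?thesis unfolding C_def using B order_trans by blast
  qed
  then have "\<Union> (range C) = UNIV" by blast
  then have "interior (\<Union> (range C)) \<noteq> {}" by simp
  then have "\<exists>m. interior (C m) \<noteq> {}"
    using Baire_category_alt[of "euclidean :: 'v topology" "range C"] closed_C
      completely_metrizable_space_euclidean
    by auto
  then obtain m where "interior (C m) \<noteq> {}" by blast
  then obtain x0 \<delta> where ball: "\<delta> > 0" "ball x0 \<delta> \<subseteq> C m"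
    by (meson all_not_in_conv mem_interior)
  have "norm (g x) \<le> (4 * real m / \<delta>) * norm x" for x
  proof (rule LIMSEQ_le_const2[OF tendsto_norm[OF lim]], intro exI allI impI)
    fix n
    interpret bounded_linear "f n" by (rule f)
    show "norm (f n x) \<le> (4 * real m / \<delta>) * norm x"
    proof (cases "x = 0")
      case False
      define r where "r = \<delta> / (2 * norm x)"
      have r: "r > 0" using ball(1) False by (simp add: r_def)
      have "norm (r *\<^sub>R x) < \<delta>" using ball(1) False by (simp add: r_def)
      then have "x0 + r *\<^sub>R x \<in> C m" "x0 \<in> C m" using ball by (auto simp: dist_norm)
      then have "norm (f n (x0 + r *\<^sub>R x)) \<le> m" "norm (f n x0) \<le> m" by (auto simp: C_def)
      then have "norm (f n (x0 + r *\<^sub>R x) - f n x0) \<le> 2 * m"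
        using norm_triangle_ineq4[of "f n (x0 + r *\<^sub>R x)" "f n x0"] by linarith
      then have "r * norm (f n x) \<le> 2 * m" using r by (simp add: add scaleR)
      then show ?thesis using ball(1) False by (simp add: r_def field_simps)
    qed (simp add: zero)
  qed
  then show ?thesis by blast
qed

text \<open>What is kept of a generalized derivation is that \<open>D (a * c)\<close> is a sum of two maps, each bounded
and linear in one of the variables.  The operators \<open>T\<close> express that \<open>B\<close> is a left module map in
its first variable.\<close>

locale splitting =
  fixes D :: "'a::cstar_algebra \<Rightarrow> 'x::real_normed_vector"
    and E B :: "'a \<Rightarrow> 'a \<Rightarrow> 'x" and T :: "'a \<Rightarrow> 'x \<Rightarrow> 'x"
  assumes linear_D: "linear D"
    and D_mult: "D (a * c) = E a c + B a c"
    and bounded_E: "bounded_linear (E a)"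
    and bounded_B: "bounded_linear (\<lambda>a. B a c)"
    and bounded_T: "bounded_linear (T b)"
    and B_mult: "B (b * a) c = T b (B a c)"
begin

definition J where "J = {a. \<exists>K. \<forall>c. norm (D (a * c)) \<le> K * norm c}"

lemma linear_B: "linear (B a)"
proof -
  interpret E: bounded_linear "E a" by (rule bounded_E)
  have "B a c = D (a * c) - E a c" for c by (simp add: D_mult)
  then show ?thesis
    by (intro linearI) (simp_all add: distrib_left linear_add[OF linear_D] linear_scale[OF linear_D]
        E.add E.scaleR scaleR_diff_right)
qed

lemma mem_J_iff: "a \<in> J \<longleftrightarrow> bounded_linear (B a)"
proof -
  obtain KE where KE: "\<And>c. norm (E a c) \<le> norm c * KE"
    using bounded_linear.bounded[OF bounded_E] by blast
  show ?thesis
  proof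
    assume "a \<in> J"
    then obtain K where K: "\<And>c. norm (D (a * c)) \<le> K * norm c" by (auto simp: J_def)
    have "norm (B a c) \<le> norm c * (K + KE)" for c
      using K[of c] KE[of c] norm_triangle_ineq4[of "D (a * c)" "E a c"]
      by (simp add: D_mult algebra_simps)
    then show "bounded_linear (B a)"
      using linear_B[of a]
      by (intro bounded_linear_intro[where K = "K + KE"]) (auto simp: linear_add linear_scale)
  next
    assume "bounded_linear (B a)"
    then obtain K where K: "\<And>c. norm (B a c) \<le> norm c * K"
      using bounded_linear.bounded by blast
    have "norm (D (a * c)) \<le> (K + KE) * norm c" for c
      using K[of c] KE[of c] norm_triangle_ineq[of "E a c" "B a c"]
      by (simp add: D_mult algebra_simps)
    then show "a \<in> J" by (auto simp: J_def)
  qed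
qed

lemma closed_J: "closed J"
proof (unfold closed_sequential_limits, intro allI impI, elim conjE)
  fix a l assume a: "\<forall>n. a n \<in> J" and l: "a \<longlonglongrightarrow> l"
  have "\<exists>K. \<forall>c. norm (B l c) \<le> K * norm c"
  proof (rule bounded_pointwise_limit)
    show "bounded_linear (B (a n))" for n using a by (simp add: mem_J_iff)
    show "(\<lambda>n. B (a n) c) \<longlonglongrightarrow> B l c" for c by (rule bounded_linear.tendsto[OF bounded_B l])
  qed
  then obtain K where "\<And>c. norm (B l c) \<le> norm c * K" by (auto simp: mult.commute)
  then have "bounded_linear (B l)"
    using linear_B[of l]
    by (intro bounded_linear_intro[where K = K]) (auto simp: linear_add linear_scale)
  then show "l \<in> J" by (simp add: mem_J_iff)
qed

sublocale closed_ideal J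
proof
  show "subspace J"
  proof (rule subspaceI)
    interpret B: bounded_linear "\<lambda>a. B a c" for c by (rule bounded_B)
    have eq: "B 0 = (\<lambda>_. 0)" "B (x + y) = (\<lambda>c. B x c + B y c)" "B (r *\<^sub>R x) = (\<lambda>c. r *\<^sub>R B x c)"
      for x y r by (simp_all add: fun_eq_iff B.zero B.add B.scaleR)
    show "0 \<in> J" by (simp add: mem_J_iff eq bounded_linear_zero)
    show "x + y \<in> J" if "x \<in> J" "y \<in> J" for x y
      using that by (simp add: mem_J_iff eq bounded_linear_add)
    show "r *\<^sub>R x \<in> J" if "x \<in> J" for r x
      using that by (simp add: mem_J_iff eq bounded_linear_const_scaleR)
  qed
  show "closed J" by (rule closed_J)
  show "b * a \<in> J" if "a \<in> J" for a b
  proof -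
    have "bounded_linear (\<lambda>c. T b (B a c))"
      using that bounded_linear_compose[OF bounded_T] by (simp add: mem_J_iff)
    moreover have "B (b * a) = (\<lambda>c. T b (B a c))" by (simp add: fun_eq_iff B_mult)
    ultimately show ?thesis by (simp add: mem_J_iff)
  qed
  show "a * b \<in> J" if "a \<in> J" for a b
  proof -
    obtain K where K: "\<And>c. norm (D (a * c)) \<le> K * norm c"
      using \<open>a \<in> J\<close> by (auto simp: J_def)
    have "norm (D (a * b * c)) \<le> (\<bar>K\<bar> * norm b) * norm c" for c
    proof -
      have "norm (D (a * (b * c))) \<le> \<bar>K\<bar> * norm (b * c)"
        using K[of "b * c"] mult_right_mono[OF abs_ge_self, of "norm (b * c)" K] by simp
      also have "\<dots> \<le> \<bar>K\<bar> * (norm b * norm c)"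
        by (intro mult_left_mono norm_mult_ineq) simp
      finally show ?thesis by (simp add: mult.assoc)
    qed
    then show ?thesis by (auto simp: J_def)
  qed
qed

lemma scaleC_mem:
  assumes "a \<in> J"
  shows "z *\<^sub>C a \<in> J"
proof -
  obtain K where K: "\<And>c. norm (D (a * c)) \<le> K * norm c" using assms by (auto simp: J_def)
  have "norm (D ((z *\<^sub>C a) * c)) \<le> (K * cmod z) * norm c" for c
    using K[of "z *\<^sub>C c"] by (simp add: mult_scaleC_left mult_scaleC_right norm_scaleC mult.assoc)
  then show ?thesis by (auto simp: J_def)
qed

lemma bounded_on_J: "\<exists>K. \<forall>x\<in>J. norm (D x) \<le> K * norm x"
  by (rule bounded_if_left_multiples_bounded[OF linear_D]) (simp add: J_def)

lemma not_mem_J_large_values: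
  assumes "a \<notin> J" and "\<rho> > 0"
  obtains c where "norm c \<le> \<rho>" and "norm (D (a * c)) \<ge> M"
proof -
  have "\<not> (\<forall>c. norm (D (a * c)) \<le> (\<bar>M\<bar> / \<rho>) * norm c)"
    using assms(1) unfolding J_def by blast
  then obtain c0 where c0: "norm (D (a * c0)) > (\<bar>M\<bar> / \<rho>) * norm c0"
    by (auto simp: not_le)
  then have "c0 \<noteq> 0" using linear_0[OF linear_D] by auto
  define r where "r = \<rho> / norm c0"
  have r: "r > 0" using \<open>c0 \<noteq> 0\<close> assms(2) by (simp add: r_def)
  have "norm (D (a * (r *\<^sub>R c0))) = r * norm (D (a * c0))"
    using r by (simp add: linear_scale[OF linear_D])
  also have "\<dots> \<ge> r * ((\<bar>M\<bar> / \<rho>) * norm c0)" using c0 r by (intro mult_left_mono) auto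
  also have "r * ((\<bar>M\<bar> / \<rho>) * norm c0) = \<bar>M\<bar>"
    using \<open>c0 \<noteq> 0\<close> assms(2) by (simp add: r_def)
  finally show ?thesis using \<open>c0 \<noteq> 0\<close> assms(2) by (intro that[of "r *\<^sub>R c0"]) (auto simp: r_def)
qed

text \<open>Choose \<open>c n\<close> small but with \<open>D (a n * b n * c n)\<close> very large, and let \<open>l\<close> be the sum of the
\<open>b n * c n\<close>.  In \<open>a n * l\<close> the later terms lie in \<open>J\<close>, where \<open>D\<close> is bounded, and the earlier ones
are known when \<open>c n\<close> is chosen; so \<open>D (a n * l)\<close> has norm at least \<open>n\<close> plus \<open>n\<close> times a bound
for \<open>E (a n)\<close>.  But the norm of \<open>E (a n) l + B (a n) l\<close> exceeds that bound times \<open>norm l\<close> by a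
bounded amount only, since \<open>a n\<close> is bounded.\<close>

lemma gliding_hump_normalized:
  fixes a b :: "nat \<Rightarrow> 'a"
  assumes a: "\<And>n. norm (a n) \<le> 1" and b: "\<And>n. norm (b n) \<le> 1"
    and later: "\<And>n m. n < m \<Longrightarrow> a n * b m \<in> J" and diag: "\<And>n. a n * b n \<notin> J"
  shows False
proof -
  obtain K where K: "\<And>x. x \<in> J \<Longrightarrow> norm (D x) \<le> K * norm x" using bounded_on_J by blast
  have "\<exists>KE. \<forall>c. norm (E x c) \<le> norm c * KE" for x
    using bounded_linear.bounded[OF bounded_E] by blast
  then obtain KE where KE: "\<And>x c. norm (E x c) \<le> norm c * KE x" by metis
  \<comment> \<open>The states are the partial sums; \<open>KE (a n)\<close> is weighted with \<open>n\<close> because the norm of the limit is not known yet.\<close>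
  define step where "step n s s' \<longleftrightarrow> (\<exists>c. s' = s + b n * c \<and> norm c \<le> (1/2) ^ n \<and>
    norm (D (a n * (b n * c))) \<ge> real n + real n * \<bar>KE (a n)\<bar> + norm (D (a n * s)) + \<bar>K\<bar>)"
    for n :: nat and s s' :: 'a
  have "\<exists>s'. step n s s'" for n s
    using not_mem_J_large_values[OF diag, of "(1/2) ^ n"] unfolding step_def
    by (metis mult.assoc zero_less_divide_1_iff zero_less_numeral zero_less_power)
  then obtain s where s: "\<And>n. step n (s n) (s (Suc n))"
    using dependent_nat_choice[of "\<lambda>_ _. True" step] by auto
  then obtain c where c: "\<And>n. s (Suc n) = s n + b n * c n" "\<And>n. norm (c n) \<le> (1/2) ^ n"
    "\<And>n. norm (D (a n * (b n * c n))) \<ge> real n + real n * \<bar>KE (a n)\<bar> + norm (D (a n * s n)) + \<bar>K\<bar>"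
    unfolding step_def by metis
  have "norm (s (Suc n) - s n) \<le> 1 * (1/2) ^ n" for n
    using norm_mult_ineq[of "b n" "c n"] mult_right_mono[OF b, of "norm (c n)" n] c(2)[of n]
    by (simp add: c(1))
  then obtain l where l: "s \<longlonglongrightarrow> l" by (rule geometric_increments_converge)
  obtain KB where KB: "\<And>x. norm (B x l) \<le> norm x * KB"
    using bounded_linear.bounded[OF bounded_B] by blast
  obtain N where N: "\<And>n. n \<ge> N \<Longrightarrow> norm (s n - l) < 1" using LIMSEQ_D[OF l, of 1] by auto
  obtain n where n: "real n > max (norm l) (max \<bar>KB\<bar> (real N))" using reals_Archimedean2 by blast
  have "n \<ge> N" using n by simp
  \<comment> \<open>The terms after the \<open>n\<close>-th contribute an element of \<open>J\<close>, which survives the passage to the limit.\<close>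
  have "a n * (s k - s (Suc n)) \<in> J" if "k \<ge> Suc n" for k
    using that
  proof (induction k rule: dec_induct)
    case (step k)
    have "a n * b k * c k \<in> J" by (rule mult_right) (use later step in simp)
    with step.IH have "a n * (s k - s (Suc n)) + a n * b k * c k \<in> J" by (rule add)
    then show ?case by (simp add: c(1) algebra_simps)
  qed (simp add: zero)
  then have "\<forall>\<^sub>F k in sequentially. a n * (s k - s (Suc n)) \<in> J"
    by (rule eventually_sequentiallyI)
  then have rJ: "a n * (l - s (Suc n)) \<in> J"
    by (rule Lim_in_closed_set[OF closed _ sequentially_bot]) (intro tendsto_intros l)
  have "norm (a n * (l - s (Suc n))) \<le> 1 * 1"
    using norm_mult_ineq[of "a n" "l - s (Suc n)"] mult_mono[OF a[of n], of "norm (l - s (Suc n))" 1]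
      N[of "Suc n"] \<open>n \<ge> N\<close> by (simp add: norm_minus_commute)
  then have r: "norm (D (a n * (l - s (Suc n)))) \<le> \<bar>K\<bar>"
    using K[OF rJ] mult_mono[OF abs_ge_self[of K], of "norm (a n * (l - s (Suc n)))" 1] by simp
  have "a n * (b n * c n) = a n * l - a n * s n - a n * (l - s (Suc n))"
    by (simp add: c(1) algebra_simps)
  then have "D (a n * (b n * c n)) = D (a n * l) - D (a n * s n) - D (a n * (l - s (Suc n)))"
    by (simp add: linear_diff[OF linear_D])
  then have "norm (D (a n * (b n * c n)))
      \<le> norm (D (a n * l)) + norm (D (a n * s n)) + norm (D (a n * (l - s (Suc n))))"
    by (metis (no_types, opaque_lifting) add_right_mono norm_triangle_ineq4 order_trans)
  with c(3)[of n] r have lower: "norm (D (a n * l)) \<ge> real n + real n * \<bar>KE (a n)\<bar>" by linarith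
  have "norm (B (a n) l) \<le> \<bar>KB\<bar>"
    using KB[of "a n"] mult_mono[OF a[of n], of KB "\<bar>KB\<bar>"]
    by (smt (verit) mult_left_le_one_le mult_nonneg_nonpos norm_ge_zero a)
  moreover have "norm (E (a n) l) \<le> real n * \<bar>KE (a n)\<bar>"
  proof -
    have "norm (E (a n) l) \<le> norm l * \<bar>KE (a n)\<bar>"
      using KE[of "a n" l] mult_left_mono[OF abs_ge_self norm_ge_zero[of l], of "KE (a n)"]
      by (rule order_trans)
    also have "\<dots> \<le> real n * \<bar>KE (a n)\<bar>" using n by (intro mult_right_mono) auto
    finally show ?thesis .
  qed
  ultimately have "norm (D (a n * l)) \<le> real n * \<bar>KE (a n)\<bar> + \<bar>KB\<bar>"
    unfolding D_mult using norm_triangle_ineq[of "E (a n) l" "B (a n) l"] by linarith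
  then show False using lower n by linarith
qed

lemma gliding_hump:
  fixes a b :: "nat \<Rightarrow> 'a"
  assumes "\<And>n m. n < m \<Longrightarrow> a n * b m \<in> J" and "\<And>n. a n * b n \<notin> J"
  shows False
proof (rule gliding_hump_normalized)
  let ?u = "\<lambda>x::'a. inverse (norm x) *\<^sub>R x"
  have u: "norm (?u x) \<le> 1" for x by (cases "x = 0") simp_all
  show "norm (?u (a n)) \<le> 1" "norm (?u (b n)) \<le> 1" for n by (rule u)+
  show "?u (a n) * ?u (b m) \<in> J" if "n < m" for n m
    using scale[OF scale[OF assms(1)[OF that]]] by simp
  show "?u (a n) * ?u (b n) \<notin> J" for n
  proof
    assume "?u (a n) * ?u (b n) \<in> J"
    then have "norm (a n) *\<^sub>R norm (b n) *\<^sub>R (?u (a n) * ?u (b n)) \<in> J" by (intro scale)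
    moreover have "a n \<noteq> 0" "b n \<noteq> 0" using assms(2)[of n] zero by auto
    then have "norm (a n) *\<^sub>R norm (b n) *\<^sub>R (?u (a n) * ?u (b n)) = a n * b n"
      by (simp add: field_simps)
    ultimately show False using assms(2)[of n] by simp
  qed
qed

text \<open>The right annihilator of \<open>S\<close> modulo \<open>J\<close>.\<close>

definition ran where "ran S = {b. \<forall>s\<in>S. s * b \<in> J}"

text \<open>A set \<open>S\<close> for which the annihilator is minimal subject to \<open>P\<close> (among one-element enlargements).
Otherwise enlarging \<open>S\<close> by \<open>s 0, s 1, \<dots>\<close> gives a strictly decreasing chain of annihilators, and
elements \<open>b n\<close> of the \<open>n\<close>-th one that \<open>s n\<close> does not annihilate contradict the gliding hump.\<close>

lemma stable_annihilator:
  assumes "P {}"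
  obtains S where "P S" and "\<And>s. P (insert s S) \<Longrightarrow> ran (insert s S) = ran S"
proof -
  have "\<exists>S. P S \<and> (\<forall>s. P (insert s S) \<longrightarrow> ran (insert s S) = ran S)"
  proof (rule ccontr)
    assume contr: "\<not> ?thesis"
    define step where "step n S S' \<longleftrightarrow> (\<exists>s b. S' = insert s S \<and> b \<in> ran S \<and> s * b \<notin> J)"
      for n :: nat and S S'
    have "\<exists>S'. P S' \<and> step n S S'" if PS: "P S" for n S
    proof -
      obtain s where s: "P (insert s S)" "ran (insert s S) \<noteq> ran S" using contr PS by blast
      then obtain b where "b \<in> ran S" "s * b \<notin> J" by (auto simp: ran_def)
      then show ?thesis using s(1) unfolding step_def by blast
    qed
    then have "\<exists>S. \<forall>n. P (S n) \<and> step n (S n) (S (Suc n))"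
      using assms by (intro dependent_nat_choice[of "\<lambda>_. P" step]) auto
    then obtain S where S: "\<And>n. step n (S n) (S (Suc n))" by blast
    then obtain s b where sb: "\<And>n. S (Suc n) = insert (s n) (S n)" "\<And>n. b n \<in> ran (S n)"
      "\<And>n. s n * b n \<notin> J"
      unfolding step_def by metis
    have "s n * b m \<in> J" if "n < m" for n m
    proof -
      have "S (Suc n) \<subseteq> S m" by (rule lift_Suc_mono_le[of S]) (use that sb(1) in auto)
      then have "s n \<in> S m" using sb(1) by auto
      then show ?thesis using sb(2)[of m] by (simp add: ran_def)
    qed
    then show False using gliding_hump sb(3) by blast
  qed
  then show ?thesis using that by blast
qed

end

section \<open>The continuity ideal is everything\<close>

context splitting
begin

lemma subspace_ran: "subspace (ran S)"
  by (rule subspaceI) (auto simp: ran_def distrib_left zero add scale)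

lemma closed_ran: "closed (ran S)"
proof -
  have "ran S = (\<Inter>s\<in>S. (\<lambda>b. s * b) -` J)" by (auto simp: ran_def)
  then show ?thesis
    by (auto intro!: closed_INT closed_vimage closed continuous_intros)
qed

lemma ran_mult_right: "b \<in> ran S \<Longrightarrow> b * c \<in> ran S"
  using mult_right by (auto simp: ran_def mult.assoc[symmetric])

text \<open>Modulo \<open>J\<close>, the spectrum of \<open>x\<close> is contained in \<open>{0, sqrt \<mu>, - sqrt \<mu>}\<close>.  The elements obtained from
\<open>max 0 (t\<^sup>2 - s)\<close> and \<open>max 0 (s - t\<^sup>2)\<close>, each times \<open>t\<close>, have product zero, so one of them lies in \<open>J\<close>
for every \<open>s\<close>.  At the smallest \<open>\<nu>\<close> for which the first one does, closedness of \<open>J\<close> puts both of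
them in \<open>J\<close>, and their difference is \<open>h\<^sup>3 - \<nu> h\<close>.  Here \<open>h\<close> is the element \<open>x\<close>, rescaled.\<close>

lemma cubic_relation:
  assumes prime: "\<And>s a. \<lbrakk>s \<in> ran S; star s = s; a \<in> ran S; s * a \<in> J\<rbrakk> \<Longrightarrow> s \<in> J \<or> a \<in> J"
    and x: "x \<in> ran S" "star x = x" "x \<notin> J"
  obtains \<mu> where "\<mu> > 0" and "x * x * x - \<mu> *\<^sub>R x \<in> J"
proof -
  define r where "r = inverse (2 * (1 + norm x))"
  have pos: "1 + norm x > 0" by (simp add: add_pos_nonneg)
  then have r: "r > 0" by (simp add: r_def)
  define h where "h = r *\<^sub>R x"
  have hR: "h \<in> ran S" unfolding h_def by (rule subspace_scale[OF subspace_ran x(1)])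
  have hJ: "h \<notin> J"
  proof
    assume "h \<in> J"
    then have "inverse r *\<^sub>R h \<in> J" by (rule scale)
    then show False using r x(3) by (simp add: h_def)
  qed
  interpret small_selfadjoint h
  proof
    show "star h = h" by (simp add: h_def star_scaleR x)
    show "norm h \<le> 1/2" using pos by (simp add: h_def r_def field_simps)
  qed
  define u v where "u s t = max 0 (t\<^sup>2 - s)" and "v s t = max 0 (s - t\<^sup>2)" for s t :: real
  have cont: "continuous_on {-1..1} (u s)" "continuous_on {-1..1} (v s)" for s
    unfolding u_def v_def by (intro continuous_intros)+
  have fR: "fcalc f h \<in> ran S" if "continuous_on {-1..1} f" for f
    by (rule fcalc_mem[OF that subspace_ran closed_ran ran_mult_right[OF hR] hR])
  define a b where "a s = fcalc (u s) h" and "b s = fcalc (v s) h" for s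
  have ab: "a s \<in> J \<or> b s \<in> J" for s
  proof (rule prime)
    have uv: "(\<lambda>t. u s t * (t * v s t)) = (\<lambda>_. 0)"
      by (rule ext) (simp add: u_def v_def max_def)
    show "a s * b s \<in> J"
      unfolding a_def b_def fcalc_h_mult_fcalc_h[OF cont] uv
      using fcalc_const[of 0 h] zero by simp
  qed (simp_all add: a_def b_def fR cont star_fcalc_h)
  have lipschitz: "dist (a s) (a s') \<le> \<bar>s - s'\<bar>" "dist (b s) (b s') \<le> \<bar>s - s'\<bar>" for s s'
    unfolding a_def b_def dist_norm
    by (rule norm_fcalc_h_diff_le[OF cont(1) cont(1)] norm_fcalc_h_diff_le[OF cont(2) cont(2)],
        simp add: u_def v_def)+
  have a1: "a 1 \<in> J"
  proof -
    have "u 1 t = 0" if "\<bar>t\<bar> \<le> 1" for t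
      using power_mono[OF that, of 2] by (simp add: u_def)
    then have "fcalc (u 1) = fcalc (\<lambda>_. 0)" by (rule fcalc_cong)
    then show ?thesis using fcalc_const[of 0 h] zero by (simp add: a_def)
  qed
  define A where "A = {s. s \<ge> 0 \<and> a s \<in> J}"
  define \<nu> where "\<nu> = Inf A"
  have "1 \<in> A" using a1 by (simp add: A_def)
  then have A: "A \<noteq> {}" by blast
  have bdd: "bdd_below A" by (rule bdd_belowI[of _ 0]) (simp add: A_def)
  have "\<nu> \<ge> 0" unfolding \<nu>_def by (rule cInf_greatest[OF A]) (simp add: A_def)
  have aJ: "a \<nu> \<in> J"
  proof -
    have "\<exists>y\<in>J. dist y (a \<nu>) < \<epsilon>" if "\<epsilon> > 0" for \<epsilon>
    proof -
      obtain s where s: "s \<in> A" "s < \<nu> + \<epsilon>"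
        using cInf_lessD[OF A, of "\<nu> + \<epsilon>"] \<open>\<epsilon> > 0\<close> by (auto simp: \<nu>_def)
      moreover have "\<nu> \<le> s" unfolding \<nu>_def by (rule cInf_lower[OF s(1) bdd])
      ultimately have "dist (a s) (a \<nu>) < \<epsilon>" using lipschitz(1)[of s \<nu>] by linarith
      then show ?thesis using s(1) by (auto simp: A_def)
    qed
    then show ?thesis using closed by (meson closed_approachable)
  qed
  have bJ: "b \<nu> \<in> J"
  proof (cases "\<nu> = 0")
    case True
    have "v 0 = (\<lambda>_. 0)" by (simp add: v_def fun_eq_iff)
    then show ?thesis using True fcalc_const[of 0 h] zero by (simp add: b_def)
  next
    case False
    have "\<exists>y\<in>J. dist y (b \<nu>) < \<epsilon>" if "\<epsilon> > 0" for \<epsilon>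
    proof -
      define s where "s = max 0 (\<nu> - \<epsilon> / 2)"
      have s: "0 \<le> s" "s < \<nu>" "\<bar>s - \<nu>\<bar> < \<epsilon>" using \<open>\<epsilon> > 0\<close> \<open>\<nu> \<ge> 0\<close> False by (auto simp: s_def)
      have "s \<notin> A" using s(2) cInf_lower[OF _ bdd, of s] by (auto simp: \<nu>_def)
      then have "b s \<in> J" using ab[of s] s(1) by (auto simp: A_def)
      moreover have "dist (b s) (b \<nu>) < \<epsilon>" using lipschitz(2)[of s \<nu>] s(3) by linarith
      ultimately show ?thesis by blast
    qed
    then show ?thesis using closed by (meson closed_approachable)
  qed
  have "u \<nu> t - v \<nu> t = t * t + (- \<nu>)" for t by (simp add: u_def v_def max_def power2_eq_square)
  then have "a \<nu> - b \<nu> = fcalc (\<lambda>t. t * t + (- \<nu>)) h"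
    unfolding a_def b_def by (simp add: fcalc_h_diff[OF cont, symmetric])
  also have "\<dots> = h * (h * h) - \<nu> *\<^sub>R h"
    using fcalc_add[of "\<lambda>t. t * t" "\<lambda>_. - \<nu>" h] fcalc_mult[of "\<lambda>t. t" "\<lambda>t. t" h]
      fcalc_const[of "- \<nu>" h] by (simp add: fcalc_id continuous_intros)
  finally have cubic: "h * (h * h) - \<nu> *\<^sub>R h \<in> J" using diff[OF aJ bJ] by simp
  have "\<nu> \<noteq> 0"
  proof
    assume "\<nu> = 0"
    then have "h * (h * h) \<in> J" using cubic by simp
    then have "h * h \<in> J" using prime[OF hR selfadjoint ran_mult_right[OF hR]] hJ by blast
    then show False using mem_if_mult_star_mem[of h] hJ by (simp add: selfadjoint)
  qed
  have "inverse (r ^ 3) *\<^sub>R (h * (h * h) - \<nu> *\<^sub>R h) = x * x * x - (\<nu> / r\<^sup>2) *\<^sub>R x"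
    using r by (simp add: h_def scaleR_diff_right field_simps power3_eq_cube power2_eq_square mult.assoc)
  then show ?thesis
    using scale[OF cubic, of "inverse (r ^ 3)"] \<open>\<nu> \<noteq> 0\<close> \<open>\<nu> \<ge> 0\<close> r by (intro that[of "\<nu> / r\<^sup>2"]) auto
qed

text \<open>In a minimal annihilator that is not contained in \<open>J\<close>, a selfadjoint element of it annihilates
modulo \<open>J\<close> only those of its elements that lie in \<open>J\<close>, unless it lies in \<open>J\<close> itself.  The cubic relation makes a multiple of \<open>h\<^sup>2\<close> a
projection \<open>p\<close>.  Modulo \<open>J\<close>, it also gives \<open>y\<^sup>2 = \<nu> p\<close> for selfadjoint \<open>y\<close> in the corner of \<open>p\<close>; as
\<open>(y - sqrt \<nu> p) (y + sqrt \<nu> p)\<close> vanishes, \<open>y\<close> is a real multiple of \<open>p\<close>.\<close>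

lemma minimal_projection:
  assumes "J \<noteq> UNIV"
  obtains p where "star p = p" and "p \<notin> J" and "p * p - p \<in> J"
    and "\<And>k. \<exists>z. p * k * p - z *\<^sub>C p \<in> J"
proof -
  have "\<not> ran {} \<subseteq> J" using assms by (auto simp: ran_def)
  then obtain S where S: "\<not> ran S \<subseteq> J" "\<And>s. \<not> ran (insert s S) \<subseteq> J \<Longrightarrow> ran (insert s S) = ran S"
    using stable_annihilator[of "\<lambda>S. \<not> ran S \<subseteq> J"] by metis
  note R_scale = subspace_scale[OF subspace_ran] and R_diff = subspace_diff[OF subspace_ran]
    and R_add = subspace_add[OF subspace_ran]
  have prime: "s \<in> J \<or> a \<in> J" if s: "s \<in> ran S" "star s = s" and a: "a \<in> ran S" "s * a \<in> J" for s a
  proof (rule disjCI)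
    assume "a \<notin> J"
    then have "ran (insert s S) = ran S" using S(2)[of s] a by (auto simp: ran_def)
    then have "s * s \<in> J" using s(1) by (auto simp: ran_def)
    then show "s \<in> J" using mem_if_mult_star_mem[of s] s(2) by simp
  qed
  obtain x where x: "x \<in> ran S" "x \<notin> J" using S(1) by blast
  define h where "h = x * star x"
  have h: "h \<in> ran S" "star h = h" "h \<notin> J"
    using x mem_if_mult_star_mem[of x] by (auto simp: h_def star_mult star_star ran_mult_right)
  obtain \<mu> where \<mu>: "\<mu> > 0" "h * h * h - \<mu> *\<^sub>R h \<in> J"
    using cubic_relation[OF prime h] by blast
  define p where "p = inverse \<mu> *\<^sub>R (h * h)"
  have pR: "p \<in> ran S" unfolding p_def by (intro R_scale ran_mult_right h)
  have star_p: "star p = p" by (simp add: p_def star_scaleR star_mult h)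
  have pJ: "p \<notin> J"
  proof
    assume "p \<in> J"
    then have "\<mu> *\<^sub>R p \<in> J" by (rule scale)
    then show False using mem_if_mult_star_mem[of h] h \<mu>(1) by (simp add: p_def)
  qed
  have pp: "p * p - p \<in> J"
  proof -
    have "(inverse \<mu> * inverse \<mu>) *\<^sub>R ((h * h * h - \<mu> *\<^sub>R h) * h) \<in> J"
      by (intro scale mult_right \<mu>)
    moreover have "(inverse \<mu> * inverse \<mu>) *\<^sub>R ((h * h * h - \<mu> *\<^sub>R h) * h) = p * p - p"
      using \<mu>(1) by (simp add: p_def algebra_simps)
    ultimately show ?thesis by simp
  qed
  have selfadj: "\<exists>r. p * k * p - r *\<^sub>R p \<in> J" if k: "star k = k" for k
  proof (cases "p * k * p \<in> J")
    case False
    define y where "y = p * k * p"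
    have y: "y \<in> ran S" "star y = y" "y \<notin> J"
      using False k by (auto simp: y_def ran_mult_right pR star_mult star_p mult.assoc)
    obtain \<nu> where \<nu>: "\<nu> > 0" "y * y * y - \<nu> *\<^sub>R y \<in> J"
      using cubic_relation[OF prime y] by blast
    have yp: "y * p - y \<in> J"
    proof -
      have "p * k * (p * p - p) \<in> J" by (rule mult_left[OF pp])
      then show ?thesis by (simp add: y_def algebra_simps)
    qed
    have py: "p * y - y \<in> J"
    proof -
      have "(p * p - p) * (k * p) \<in> J" by (rule mult_right[OF pp])
      then show ?thesis by (simp add: y_def algebra_simps)
    qed
    have "y * (y * y - \<nu> *\<^sub>R p) \<in> J"
    proof -
      have "(y * y * y - \<nu> *\<^sub>R y) - \<nu> *\<^sub>R (y * p - y) \<in> J" by (intro diff scale \<nu> yp)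
      then show ?thesis by (simp add: algebra_simps)
    qed
    moreover have "y * y - \<nu> *\<^sub>R p \<in> ran S" by (intro R_diff R_scale ran_mult_right y pR)
    ultimately have quadratic: "y * y - \<nu> *\<^sub>R p \<in> J" using prime[OF y(1,2)] y(3) by blast
    define t where "t = sqrt \<nu>"
    have t: "t * t = \<nu>" using \<nu>(1) by (simp add: t_def)
    have "(y - t *\<^sub>R p) * (y + t *\<^sub>R p) \<in> J"
    proof -
      have "(y * y - \<nu> *\<^sub>R p) + t *\<^sub>R ((y * p - y) - (p * y - y)) - \<nu> *\<^sub>R (p * p - p) \<in> J"
        by (intro diff add scale quadratic yp py pp)
      then show ?thesis by (simp add: algebra_simps t[symmetric])
    qed
    then have "y - t *\<^sub>R p \<in> J \<or> y + t *\<^sub>R p \<in> J"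
      by (intro prime) (auto intro!: R_diff R_add R_scale y pR simp: star_diff star_scaleR star_p y)
    then show ?thesis unfolding y_def
      by (metis scaleR_minus_left diff_minus_eq_add)
  qed (auto intro: exI[of _ 0])
  show ?thesis
  proof (rule that[OF star_p pJ pp])
    fix k :: 'a
    \<comment> \<open>The real and imaginary parts of \<open>k\<close>.\<close>
    define k1 k2 where "k1 = (1/2) *\<^sub>R (k + star k)" and "k2 = (1/2) *\<^sub>R (\<i> *\<^sub>C (star k - k))"
    have "star k1 = k1" by (simp add: k1_def star_scaleR star_add star_star add.commute)
    then obtain r1 where r1: "p * k1 * p - r1 *\<^sub>R p \<in> J" using selfadj by blast
    have "star k2 = k2"
      by (simp add: k2_def star_scaleR star_scaleC star_diff star_star
          complex_vector.scale_right_diff_distrib)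
    then obtain r2 where r2: "p * k2 * p - r2 *\<^sub>R p \<in> J" using selfadj by blast
    have "\<i> *\<^sub>C k2 = (1/2) *\<^sub>R (k - star k)"
      by (simp add: k2_def scaleC_scaleR scaleC_scaleC scaleC_one)
    then have k: "k = k1 + \<i> *\<^sub>C k2"
      by (simp add: k1_def scaleR_add_right scaleR_diff_right flip: scaleR_add_left)
    have "(p * k1 * p - r1 *\<^sub>R p) + \<i> *\<^sub>C (p * k2 * p - r2 *\<^sub>R p) \<in> J"
      by (intro add scaleC_mem r1 r2)
    also have "(p * k1 * p - r1 *\<^sub>R p) + \<i> *\<^sub>C (p * k2 * p - r2 *\<^sub>R p)
        = p * k * p - (of_real r1 + \<i> * of_real r2) *\<^sub>C p"
      by (simp add: k algebra_simps mult_scaleC_left mult_scaleC_right scaleC_add_left scaleC_of_real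
          complex_vector.scale_right_diff_distrib scaleC_scaleC[symmetric])
    finally show "\<exists>z. p * k * p - z *\<^sub>C p \<in> J" by blast
  qed
qed

text \<open>For a projection \<open>p\<close> with scalar corner modulo \<open>J\<close>, the right ideal of \<open>p\<close> behaves like a Hilbert
space with inner product \<open>x * star y\<close>.  Among its subspaces cut out by annihilator conditions, take a
minimal one on which \<open>D\<close> is unbounded: it would have to be orthogonal to each of its elements.\<close>

lemma J_eq_UNIV: "J = UNIV"
proof (rule ccontr)
  assume "J \<noteq> UNIV"
  then obtain p where p: "star p = p" "p \<notin> J" "p * p - p \<in> J"
    and corner: "\<And>k. \<exists>z. p * k * p - z *\<^sub>C p \<in> J"
    using minimal_projection by metis
  \<comment> \<open>The distance bounds the scalar \<open>z\<close> in \<open>w - z *\<^sub>C p \<in> J\<close> in terms of \<open>w\<close>.\<close>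
  define \<delta> where "\<delta> = infdist p J"
  have \<delta>: "\<delta> > 0" unfolding \<delta>_def
    using infdist_pos_not_in_closed[OF closed _ p(2)] zero by blast
  have scalar: "cmod z * \<delta> \<le> norm w" if "w - z *\<^sub>C p \<in> J" for w z
  proof (cases "z = 0")
    case False
    have "(- inverse z) *\<^sub>C (w - z *\<^sub>C p) \<in> J" using that by (rule scaleC_mem)
    then have "\<delta> \<le> dist p ((- inverse z) *\<^sub>C (w - z *\<^sub>C p))" unfolding \<delta>_def by (rule infdist_le)
    also have "\<dots> = norm (inverse z *\<^sub>C w)"
      using False by (simp add: dist_norm complex_vector.scale_right_diff_distrib scaleC_scaleC scaleC_one)
    also have "\<dots> = norm w / cmod z" by (simp add: norm_scaleC norm_inverse divide_inverse mult.commute)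
    finally show ?thesis using False by (simp add: field_simps)
  qed simp
  \<comment> \<open>Modulo \<open>J\<close>, the elements of the right ideal of \<open>p\<close> whose adjoints are annihilated by \<open>S\<close>.\<close>
  define V where "V S = {y. y - p * y \<in> J \<and> star y \<in> ran S}" for S
  define P where "P S \<longleftrightarrow> \<not> (\<exists>K. \<forall>y\<in>V S. norm (D y) \<le> K * norm y)" for S
  have "P {}"
    unfolding P_def
  proof
    assume "\<exists>K. \<forall>y\<in>V {}. norm (D y) \<le> K * norm y"
    then obtain K where K: "\<And>y. y \<in> V {} \<Longrightarrow> norm (D y) \<le> K * norm y" by blast
    have "norm (D (p * c)) \<le> (\<bar>K\<bar> * norm p) * norm c" for c
    proof -
      have "(p * p - p) * (- c) \<in> J" by (rule mult_right[OF p(3)])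
      then have "p * c \<in> V {}" by (simp add: V_def ran_def algebra_simps)
      then have "norm (D (p * c)) \<le> K * norm (p * c)" by (rule K)
      also have "\<dots> \<le> \<bar>K\<bar> * (norm p * norm c)"
        by (intro mult_mono norm_mult_ineq) auto
      finally show ?thesis by (simp add: mult.assoc)
    qed
    then show False using p(2) by (auto simp: J_def)
  qed
  then obtain S where S: "P S" "\<And>s. P (insert s S) \<Longrightarrow> ran (insert s S) = ran S"
    by (rule stable_annihilator[of P]) blast
  have V_diff: "y - c *\<^sub>C u \<in> V S" if y: "y \<in> V S" and u: "u \<in> V S" for y u c
  proof -
    have "y - p * y \<in> J" "u - p * u \<in> J" using y u by (auto simp: V_def)
    then have "(y - p * y) - c *\<^sub>C (u - p * u) \<in> J" by (metis diff scaleC_mem)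
    moreover have "s * star y - cnj c *\<^sub>C (s * star u) \<in> J" if "s \<in> S" for s
    proof -
      have "s * star y \<in> J" "s * star u \<in> J" using y u that by (auto simp: V_def ran_def)
      then show ?thesis by (intro diff scaleC_mem)
    qed
    ultimately show ?thesis
      by (simp add: V_def ran_def star_diff star_scaleC algebra_simps mult_scaleC_right
          complex_vector.scale_right_diff_distrib)
  qed
  have "V S \<subseteq> J"
  proof
    fix x assume x: "x \<in> V S"
    have "\<exists>z. p * x * star y - z *\<^sub>C p \<in> J" if y: "y \<in> V S" for y
    proof -
      obtain z where z: "p * (x * star y) * p - z *\<^sub>C p \<in> J" using corner by blast
      have "p * x * star (y - p * y) \<in> J"
        using y by (intro mult_left star_mem) (simp add: V_def)
      from add[OF this z] show ?thesis
        by (intro exI[of _ z]) (simp add: star_diff star_mult p(1) algebra_simps)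
    qed
    then obtain \<phi> where \<phi>: "\<And>y. y \<in> V S \<Longrightarrow> p * x * star y - \<phi> y *\<^sub>C p \<in> J" by metis
    \<comment> \<open>Adding \<open>p * x\<close> to \<open>S\<close> imposes a single scalar condition \<open>\<phi> y = 0\<close>; a bound for \<open>D\<close> on its solutions would extend to \<open>V S\<close> along one direction \<open>u\<close>.\<close>
    have "P (insert (p * x) S)"
      unfolding P_def
    proof
      assume "\<exists>K. \<forall>y\<in>V (insert (p * x) S). norm (D y) \<le> K * norm y"
      then obtain K where K: "\<And>y. y \<in> V (insert (p * x) S) \<Longrightarrow> norm (D y) \<le> K * norm y" by blast
      have insert: "y \<in> V (insert (p * x) S)" if "y \<in> V S" "p * x * star y \<in> J" for y
        using that by (simp add: V_def ran_def)
      have "\<exists>K. \<forall>y\<in>V S. norm (D y) \<le> K * norm y"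
      proof (cases "\<forall>y\<in>V S. p * x * star y \<in> J")
        case True
        then show ?thesis using K insert by blast
      next
        case False
        then obtain u where u: "u \<in> V S" "p * x * star u \<notin> J" by blast
        have z0: "\<phi> u \<noteq> 0" using \<phi>[OF u(1)] u(2) by auto
        define C where "C = norm (p * x) / (\<delta> * cmod (\<phi> u))"
        define L where "L = norm (D u) + norm (D (\<i> *\<^sub>C u))"
        have "norm (D y) \<le> (\<bar>K\<bar> * (1 + C * norm u) + C * L) * norm y" if y: "y \<in> V S" for y
        proof -
          \<comment> \<open>The form \<open>(x, y) \<mapsto> x * star y\<close> is conjugate linear in \<open>y\<close>.\<close>
          define c where "c = cnj (\<phi> y / \<phi> u)"
          have "cmod (\<phi> y) * \<delta> \<le> norm (p * x) * norm y"
            using scalar[OF \<phi>[OF y]] norm_mult_ineq[of "p * x" "star y"] by (simp add: norm_star)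
          then have c: "cmod c \<le> C * norm y"
            using z0 \<delta> by (simp add: c_def C_def norm_divide field_simps)
          have "(p * x * star y - \<phi> y *\<^sub>C p) - (\<phi> y / \<phi> u) *\<^sub>C (p * x * star u - \<phi> u *\<^sub>C p) \<in> J"
            by (intro diff scaleC_mem \<phi> y u)
          then have "p * x * star (y - c *\<^sub>C u) \<in> J"
            using z0 by (simp add: c_def star_diff star_scaleC right_diff_distrib mult_scaleC_right
                complex_vector.scale_right_diff_distrib scaleC_scaleC)
          then have "norm (D (y - c *\<^sub>C u)) \<le> K * norm (y - c *\<^sub>C u)"
            by (intro K insert V_diff y u)
          also have "\<dots> \<le> \<bar>K\<bar> * (norm y + cmod c * norm u)"
            using norm_triangle_ineq4[of y "c *\<^sub>C u"] by (intro mult_mono) (auto simp: norm_scaleC)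
          also have "\<dots> \<le> \<bar>K\<bar> * (norm y + (C * norm y) * norm u)"
            using c by (intro mult_left_mono add_left_mono mult_right_mono) auto
          finally have 1: "norm (D (y - c *\<^sub>C u)) \<le> \<bar>K\<bar> * (norm y + (C * norm y) * norm u)" .
          \<comment> \<open>The map \<open>D\<close> is only real linear here, so \<open>u\<close> and \<open>\<i> *\<^sub>C u\<close> count as two directions.\<close>
          have "c *\<^sub>C u = Re c *\<^sub>R u + Im c *\<^sub>R (\<i> *\<^sub>C u)"
            by (simp add: scaleC_of_real[symmetric] scaleC_scaleC scaleC_add_left[symmetric])
               (metis complex_eq mult.commute)
          then have "D (c *\<^sub>C u) = Re c *\<^sub>R D u + Im c *\<^sub>R D (\<i> *\<^sub>C u)"
            by (simp add: linear_add[OF linear_D] linear_scale[OF linear_D])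
          then have "norm (D (c *\<^sub>C u)) \<le> \<bar>Re c\<bar> * norm (D u) + \<bar>Im c\<bar> * norm (D (\<i> *\<^sub>C u))"
            by (metis norm_triangle_ineq norm_scaleR)
          also have "\<dots> \<le> cmod c * norm (D u) + cmod c * norm (D (\<i> *\<^sub>C u))"
            by (intro add_mono mult_right_mono abs_Re_le_cmod abs_Im_le_cmod) auto
          also have "\<dots> = cmod c * L" by (simp add: L_def algebra_simps)
          also have "\<dots> \<le> (C * norm y) * L"
            using c by (intro mult_right_mono) (auto simp: L_def)
          finally have 2: "norm (D (c *\<^sub>C u)) \<le> (C * norm y) * L" .
          have "D y = D (y - c *\<^sub>C u) + D (c *\<^sub>C u)" by (simp add: linear_diff[OF linear_D])
          then have "norm (D y) \<le> norm (D (y - c *\<^sub>C u)) + norm (D (c *\<^sub>C u))"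
            by (metis norm_triangle_ineq)
          also have "\<dots> \<le> \<bar>K\<bar> * (norm y + (C * norm y) * norm u) + (C * norm y) * L"
            by (rule add_mono[OF 1 2])
          also have "\<dots> = (\<bar>K\<bar> * (1 + C * norm u) + C * L) * norm y"
            by (simp add: algebra_simps)
          finally show ?thesis .
        qed
        then show ?thesis by blast
      qed
      then show False using S(1) by (simp add: P_def)
    qed
    then have "star x \<in> ran (insert (p * x) S)" using S(2) x by (simp add: V_def)
    then have "p * x * star x \<in> J" by (simp add: ran_def)
    then have "(p * x * star x) * p \<in> J" by (rule mult_right)
    then have "(p * x) * star (p * x) \<in> J" by (simp add: star_mult p(1) mult.assoc)
    then have "p * x \<in> J" by (rule mem_if_mult_star_mem)
    moreover have "x - p * x \<in> J" using x by (simp add: V_def)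
    ultimately show "x \<in> J" using add by fastforce
  qed
  then show False using bounded_on_J S(1) unfolding P_def by blast
qed

lemma bounded_linear_D: "bounded_linear D"
proof -
  obtain K where K: "\<And>x. norm (D x) \<le> K * norm x"
    using bounded_on_J by (auto simp: J_eq_UNIV)
  then show ?thesis
    using linear_D
    by (intro bounded_linear_intro[where K = K]) (auto simp: linear_add linear_scale mult.commute)
qed

end

section \<open>Generalized derivations\<close>

lemma clinear_imp_linear:
  assumes "clinear f"
  shows "linear f"
proof -
  interpret f: Vector_Spaces.linear scaleC scaleC f by (rule assms)
  show ?thesis by (rule linearI) (simp_all add: f.add f.scale flip: scaleC_of_real)
qed

text \<open>A linear map is bounded as soon as it is bounded on some ball around zero.\<close>

lemma linear_isCont_0_imp_bounded_linear:
  fixes f :: "'v::real_normed_vector \<Rightarrow> 'w::real_normed_vector"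
  assumes f: "linear f" and "isCont f 0"
  shows "bounded_linear f"
proof -
  have "\<exists>\<delta>>0. \<forall>x. dist x 0 < \<delta> \<longrightarrow> dist (f x) (f 0) < 1"
    using assms(2) unfolding continuous_at_eps_delta by (meson zero_less_one)
  then obtain \<delta> where \<delta>: "\<delta> > 0" "\<And>x. norm x < \<delta> \<Longrightarrow> norm (f x) < 1"
    by (auto simp: linear_0[OF f] dist_norm)
  have "norm (f x) \<le> norm x * (2 / \<delta>)" for x
  proof (cases "x = 0")
    case False
    define r where "r = \<delta> / (2 * norm x)"
    have r: "r > 0" using \<delta>(1) False by (simp add: r_def)
    have "norm (f (r *\<^sub>R x)) < 1" using \<delta>(1) False by (intro \<delta>(2)) (simp add: r_def)
    then have "r * norm (f x) < 1" using r by (simp add: linear_scale[OF f])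
    then show ?thesis using \<delta>(1) False by (simp add: r_def field_simps)
  qed (simp add: linear_0[OF f])
  then show ?thesis
    using f by (intro bounded_linear_intro[where K = "2 / \<delta>"]) (auto simp: linear_add linear_scale)
qed

theorem corollary2p4:
  fixes lact :: "'b::complex_banach_algebra \<Rightarrow> 'm::complex_banach_space \<Rightarrow> 'm"
    and ract :: "'m \<Rightarrow> 'b \<Rightarrow> 'm"
    and \<sigma> \<tau> :: "'a::cstar_algebra \<Rightarrow> 'b"
    and D d :: "'a \<Rightarrow> 'm"
  assumes "banach_bimodule lact ract"
    and "isCont \<sigma> 0"
    and "isCont \<tau> 0"
    and "generalized_derivation lact ract \<sigma> \<tau> D d"
    and "(\<forall>a b c. lact (\<tau> (a * b) - \<tau> a * \<tau> b) (d c) = 0) \<or>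
         (\<forall>a b c. ract (D c) (\<sigma> (a * b) - \<sigma> a * \<sigma> b) = 0)"
  shows "continuous_on UNIV D"
proof -
  interpret banach_bimodule lact ract by (rule assms(1))
  interpret L: bounded_bilinear lact by (rule bounded_bilinear_lact)
  interpret R: bounded_bilinear ract by (rule bounded_bilinear_ract)
  have linear: "linear D" "linear d"
    and D_mult: "D (a * b) = ract (D a) (\<sigma> b) + lact (\<tau> a) (d b)" for a b
    using assms(4) by (auto simp: generalized_derivation_def intro: clinear_imp_linear)
  define E where "E a c = ract (D a) (\<sigma> c)" for a c
  define B where "B a c = lact (\<tau> a) (d c)" for a c
  have split: "D (a * c) = E a c + B a c" for a c by (simp add: D_mult E_def B_def)
  have bounded_E: "bounded_linear (E a)" for a
  proof (rule linear_isCont_0_imp_bounded_linear)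
    have "E a c = D (a * c) - lact (\<tau> a) (d c)" for c by (simp add: split B_def)
    then show "linear (E a)"
      by (intro linearI) (simp_all add: distrib_left linear_add[OF linear(1)] linear_add[OF linear(2)]
          linear_scale[OF linear(1)] linear_scale[OF linear(2)] L.add_right L.scaleR_right
          scaleR_diff_right)
    show "isCont (E a) 0" unfolding E_def by (intro R.isCont continuous_const assms(2))
  qed
  have bounded_B: "bounded_linear (\<lambda>a. B a c)" for c
  proof (rule linear_isCont_0_imp_bounded_linear)
    have "B a c = D (a * c) - ract (D a) (\<sigma> c)" for a by (simp add: split E_def)
    then show "linear (\<lambda>a. B a c)"
      by (intro linearI) (simp_all add: distrib_right linear_add[OF linear(1)]
          linear_scale[OF linear(1)] R.add_left R.scaleR_left scaleR_diff_right)
    show "isCont (\<lambda>a. B a c) 0" unfolding B_def by (intro L.isCont continuous_const assms(3))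
  qed
  have "bounded_linear D"
    using assms(5)
  proof
    assume \<tau>: "\<forall>a b c. lact (\<tau> (a * b) - \<tau> a * \<tau> b) (d c) = 0"
    interpret splitting D E B "\<lambda>b. lact (\<tau> b)"
    proof (rule splitting.intro)
      show "B (b * a) c = lact (\<tau> b) (B a c)" for a b c
        using \<tau>[rule_format, of b a c] by (simp add: B_def L.diff_left lact_mult)
    qed (fact linear split bounded_E bounded_B L.bounded_linear_right)+
    show ?thesis by (rule bounded_linear_D)
  next
    assume \<sigma>: "\<forall>a b c. ract (D c) (\<sigma> (a * b) - \<sigma> a * \<sigma> b) = 0"
    interpret star: bounded_linear "star :: 'a \<Rightarrow> 'a" by (rule bounded_linear_star)
    interpret splitting "\<lambda>x. D (star x)" "\<lambda>a c. B (star c) (star a)" "\<lambda>a c. E (star c) (star a)"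
      "\<lambda>b y. ract y (\<sigma> (star b))"
    proof (rule splitting.intro)
      show "linear (\<lambda>x. D (star x))"
        using linear_compose[OF star.linear linear(1)] by (simp add: o_def)
      show "D (star (a * c)) = B (star c) (star a) + E (star c) (star a)" for a c
        by (simp add: star_mult split add.commute)
      show "bounded_linear (\<lambda>c. B (star c) (star a))" for a
        by (rule bounded_linear_compose[OF bounded_B bounded_linear_star])
      show "bounded_linear (\<lambda>a. E (star c) (star a))" for c
        by (rule bounded_linear_compose[OF bounded_E bounded_linear_star])
      show "bounded_linear (\<lambda>y. ract y (\<sigma> (star b)))" for b by (rule R.bounded_linear_left)
      show "E (star c) (star (b * a)) = ract (E (star c) (star a)) (\<sigma> (star b))" for a b c
        using \<sigma>[rule_format, of "star c" "star a" "star b"]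
        by (simp add: E_def star_mult R.diff_right ract_mult)
    qed
    show ?thesis
      using bounded_linear_compose[OF bounded_linear_D bounded_linear_star] by (simp add: star_star)
  qed
  then show ?thesis by (rule linear_continuous_on)
qed

end
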